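(* Let $n\ge 2$, let $G$ be the $1$-skeleton of a triangulation of a convex $(n+2)$-gon (the $n+2$ sides together with $n-1$ non-crossing diagonals), and suppose the dual tree $T(G)$ is isomorphic to $T_{a,b}$ for some $a,b\ge 0$ with $a+b+2=n$. Then the number of collections of pairwise $G$-separated total orientations of $G$ that are maximal by inclusion (equivalently, maximal by size) equals $$2(n+1)\,\frac{n!}{(n-a)!}\,\frac{n!}{(n-b)!}.$$
   Context: The dual tree $T(G)$ has one vertex for each of the $n$ triangles of the triangulation, two vertices adjacent iff the triangles share a diagonal. For $a,b\ge 0$, $T_{a,b}$ is the tree on $a+b+2$ vertices consisting of the path $-a,-a+1,\dots,0,\dots,b$ together with one extra leaf $\ell$ attached to vertex $0$. Two total orientations $O_1,O_2$ of $G$ are $G$-separated if there is no cycle $C$ of $G$ that is directed in both $O_1$ and $O_2$ but in opposite directions. *)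

theory Defs
  imports Main
begin

text \<open>Polygon vertices are 0,...,N-1 (N = n+2) in cyclic order.
 A diagonal is a pair (i,j) with i < j, non-adjacent in the cycle.\<close>

definition is_diagonal :: "nat \<Rightarrow> nat \<times> nat \<Rightarrow> bool" where
  "is_diagonal N d \<longleftrightarrow> (case d of (i, j) \<Rightarrow>
      i + 2 \<le> j \<and> j < N \<and> \<not> (i = 0 \<and> j = N - 1))"

definition noncrossing :: "(nat \<times> nat) set \<Rightarrow> bool" where
  "noncrossing D \<longleftrightarrow> (\<forall>(i, j)\<in>D. \<forall>(k, l)\<in>D. \<not> (i < k \<and> k < j \<and> j < l))"

definition is_triangulation :: "nat \<Rightarrow> (nat \<times> nat) set \<Rightarrow> bool" where
  "is_triangulation N D \<longleftrightarrow> (\<forall>d\<in>D. is_diagonal N d) \<and> noncrossing D \<and> card D = N - 3"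

definition polygon_sides :: "nat \<Rightarrow> nat set set" where
  "polygon_sides N = {{i, (i + 1) mod N} | i. i < N}"

definition skeleton_edges :: "nat \<Rightarrow> (nat \<times> nat) set \<Rightarrow> nat set set" where
  "skeleton_edges N D = polygon_sides N \<union> {{i, j} | i j. (i, j) \<in> D}"

definition triangles :: "nat \<Rightarrow> (nat \<times> nat) set \<Rightarrow> nat set set" where
  "triangles N D = {t. t \<subseteq> {0..<N} \<and> card t = 3 \<and>
      (\<forall>x\<in>t. \<forall>y\<in>t. x \<noteq> y \<longrightarrow> {x, y} \<in> skeleton_edges N D)}"

definition dual_adj :: "(nat \<times> nat) set \<Rightarrow> nat set \<Rightarrow> nat set \<Rightarrow> bool" where
  "dual_adj D t1 t2 \<longleftrightarrow> t1 \<noteq> t2 \<and> (\<exists>(i, j)\<in>D. {i, j} \<subseteq> t1 \<inter> t2)"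

text \<open>The tree T_{a,b}: vertices Some i for -a \<le> i \<le> b (the path) and None (the leaf l).\<close>
definition Tab_vertices :: "nat \<Rightarrow> nat \<Rightarrow> int option set" where
  "Tab_vertices a b = Some ` {- int a .. int b} \<union> {None}"

definition Tab_adj :: "int option \<Rightarrow> int option \<Rightarrow> bool" where
  "Tab_adj x y \<longleftrightarrow>
     (x = None \<and> y = Some 0) \<or> (x = Some 0 \<and> y = None) \<or>
     (\<exists>i. x = Some i \<and> y = Some (i + 1)) \<or> (\<exists>i. x = Some (i + 1) \<and> y = Some i)"

definition dual_tree_iso_Tab :: "nat \<Rightarrow> (nat \<times> nat) set \<Rightarrow> nat \<Rightarrow> nat \<Rightarrow> bool" where
  "dual_tree_iso_Tab N D a b \<longleftrightarrow> (\<exists>f. bij_betw f (triangles N D) (Tab_vertices a b) \<and>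
      (\<forall>t1\<in>triangles N D. \<forall>t2\<in>triangles N D. dual_adj D t1 t2 \<longleftrightarrow> Tab_adj (f t1) (f t2)))"

definition total_orientation :: "nat set set \<Rightarrow> (nat \<times> nat) set \<Rightarrow> bool" where
  "total_orientation E Or \<longleftrightarrow> (\<forall>(u, v)\<in>Or. {u, v} \<in> E) \<and>
      (\<forall>u v. {u, v} \<in> E \<longrightarrow> ((u, v) \<in> Or \<longleftrightarrow> (v, u) \<notin> Or))"

definition is_cycle :: "nat set set \<Rightarrow> nat list \<Rightarrow> bool" where
  "is_cycle E vs \<longleftrightarrow> distinct vs \<and> length vs \<ge> 3 \<and>
      (\<forall>i < length vs. {vs ! i, vs ! ((i + 1) mod length vs)} \<in> E)"

definition directed_along :: "(nat \<times> nat) set \<Rightarrow> nat list \<Rightarrow> bool" where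
  "directed_along Or vs \<longleftrightarrow> (\<forall>i < length vs. (vs ! i, vs ! ((i + 1) mod length vs)) \<in> Or)"

definition G_separated :: "nat set set \<Rightarrow> (nat \<times> nat) set \<Rightarrow> (nat \<times> nat) set \<Rightarrow> bool" where
  "G_separated E Or1 Or2 \<longleftrightarrow>
     \<not> (\<exists>vs. is_cycle E vs \<and> directed_along Or1 vs \<and> directed_along Or2 (rev vs))"

definition separated_collection :: "nat set set \<Rightarrow> (nat \<times> nat) set set \<Rightarrow> bool" where
  "separated_collection E S \<longleftrightarrow> (\<forall>Or\<in>S. total_orientation E Or) \<and>
      (\<forall>Or1\<in>S. \<forall>Or2\<in>S. Or1 \<noteq> Or2 \<longrightarrow> G_separated E Or1 Or2)"

definition maximal_separated_collection :: "nat set set \<Rightarrow> (nat \<times> nat) set set \<Rightarrow> bool" where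
  "maximal_separated_collection E S \<longleftrightarrow> separated_collection E S \<and>
      (\<forall>S'. separated_collection E S' \<and> S \<subseteq> S' \<longrightarrow> S' = S)"

end

theory Submission
  imports Defs Complex_Main "HOL-Combinatorics.Permutations"
begin

text \<open>
  A separated collection chooses at most one direction for every cycle, so it is contained in the
  set \<open>S(P)\<close> of all orientations whose clockwise cycles lie in \<open>P\<close> and whose counterclockwise cycles
  do not, for some set \<open>P\<close> of cycles. A chord of a cycle directed in an orientation makes one of the
  two smaller cycles directed as well; hence \<open>P\<close> can be enlarged to a biclosed set: a set such that
  for every cycle cut by a chord, \<open>P\<close> and its complement are closed under joining the two pieces.
  Conversely, if \<open>P\<close> and \<open>Q\<close> are biclosed and distinct, a minimal cycle on which they differ forces
  the orientation of all its chords, and the resulting orientation separates \<open>S(P)\<close> from \<open>S(Q)\<close>. So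
  the maximal collections are the sets \<open>S(P)\<close> for \<open>P\<close> biclosed.

  Cycles correspond to subtrees of the dual tree. For the tree \<open>T(a,b)\<close> a biclosed set is, up to the
  sign of the leaf, a pair of linear orders on \<open>(a + 1) + (b + 1)\<close> points which agree on the left and
  on the right points, the second one moving right points up. Such a pair consists of an order of the
  left points, an order of the right points and two nested lattice paths, and the latter are counted
  by a two by two determinant.
\<close>

section \<open>Cyclically consecutive vertices\<close>

text \<open>Outerplanarity lets cycles be plain vertex sets: a cycle visits its vertices in their
  cyclic order, so each set carries only two directed versions. On the path of
  \<open>T(a,b)\<close>, a subpath in \<open>P\<close> is read as a comparison of its two end
  points, and biclosedness for subpaths says that both the comparisons and their negations are
  transitive, that is, that they form a linear order. Adding the leaf affects only subpaths through
  the branching vertex, which compare a left point with a right point; if the leaf belongs to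
  \<open>P\<close>, comparisons that hold are kept, whence the nesting. A leaf outside
  \<open>P\<close> is the complementary situation, which accounts for the factor 2. The factor
  \<open>n + 1\<close> comes from the determinant: with \<open>C = n choose (a + 1)\<close> it
  equals \<open>C^2 (1 - (a + 1)(b + 1) / ((a + 2)(b + 2)))\<close>, and
  \<open>(a + 2)(b + 2) - (a + 1)(b + 1) = a + b + 3 = n + 1\<close>.\<close>

definition cyc :: "nat \<Rightarrow> nat \<Rightarrow> nat \<Rightarrow> bool" where
  "cyc p w q \<longleftrightarrow> p < w \<and> w < q \<or> w < q \<and> q < p \<or> q < p \<and> p < w"

definition arcs :: "nat set \<Rightarrow> (nat \<times> nat) set" where
  "arcs W = {(p, q). p \<in> W \<and> q \<in> W \<and> p \<noteq> q \<and> (\<forall>w\<in>W. \<not> cyc p w q)}"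

text \<open>Of the two sides of a chord, \<open>half W p q\<close> is the one in which \<open>(p, q)\<close> becomes an arc.\<close>
definition half :: "nat set \<Rightarrow> nat \<Rightarrow> nat \<Rightarrow> nat set" where
  "half W p q = {w \<in> W. \<not> cyc p w q}"

lemma cyc_distinct: "cyc p w q \<Longrightarrow> p \<noteq> w \<and> w \<noteq> q \<and> p \<noteq> q"
  by (auto simp: cyc_def)

lemma cyc_rotate: "cyc p w q \<longleftrightarrow> cyc w q p"
  by (auto simp: cyc_def)

lemma cyc_split: "cyc x p q \<Longrightarrow> cyc p w q \<Longrightarrow> cyc x p w \<and> cyc x w q"
  by (auto simp: cyc_def)

lemma not_cyc_iff: "p \<noteq> q \<Longrightarrow> \<not> cyc p w q \<longleftrightarrow> w = p \<or> w = q \<or> cyc q w p"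
  by (auto simp: cyc_def)

lemma arcsI: "p \<in> W \<Longrightarrow> q \<in> W \<Longrightarrow> p \<noteq> q \<Longrightarrow> (\<And>w. w \<in> W \<Longrightarrow> \<not> cyc p w q) \<Longrightarrow> (p, q) \<in> arcs W"
  by (auto simp: arcs_def)

lemma arcsD:
  assumes "(p, q) \<in> arcs W"
  shows "p \<in> W" "q \<in> W" "p \<noteq> q" "w \<in> W \<Longrightarrow> \<not> cyc p w q"
  using assms by (auto simp: arcs_def)

lemma cyc_total: "p \<noteq> w \<Longrightarrow> w \<noteq> q \<Longrightarrow> p \<noteq> q \<Longrightarrow> cyc p w q \<or> cyc p q w"
  by (auto simp: cyc_def)

lemma arcs_succ_unique: "(p, q) \<in> arcs W \<Longrightarrow> (p, r) \<in> arcs W \<Longrightarrow> q = r"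
  using cyc_total[of p q r] by (auto simp: arcs_def)

lemma arcs_pred_unique: "(q, p) \<in> arcs W \<Longrightarrow> (r, p) \<in> arcs W \<Longrightarrow> q = r"
  using cyc_total[of q r p] cyc_rotate[of q p r] cyc_rotate[of p r q] by (auto simp: arcs_def)

lemma arcs_subset: "(p, q) \<in> arcs W \<Longrightarrow> U \<subseteq> W \<Longrightarrow> p \<in> U \<Longrightarrow> q \<in> U \<Longrightarrow> (p, q) \<in> arcs U"
  by (auto simp: arcs_def)

text \<open>The arc leaving \<open>Z\<close> is found by walking cyclically from an element of \<open>Z\<close> to the first
  element outside: \<open>d\<close> is the cyclic distance.\<close>
lemma arcs_leaving:
  assumes "finite W" "x \<in> W" "x \<in> Z" "y \<in> W" "y \<notin> Z"
  obtains p q where "(p, q) \<in> arcs W" "p \<in> Z" "q \<notin> Z"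
proof -
  define M where "M = Suc (Max W)"
  have M: "w < M" if "w \<in> W" for w
    unfolding M_def using that assms(1) by (simp add: less_Suc_eq_le)
  define d where "d w = (if x \<le> w then w - x else w + M - x)" for w
  obtain q where q: "q \<in> W" "q \<notin> Z" and qmin: "\<And>w. w \<in> W \<Longrightarrow> w \<notin> Z \<Longrightarrow> d q \<le> d w"
    using ex_has_least_nat[of "\<lambda>w. w \<in> W \<and> w \<notin> Z" y d] assms by blast
  have xq: "x \<noteq> q" using assms q by auto
  have d0: "d x < d q"
    using xq M[of x] M[of q] assms q by (auto simp: d_def)
  have dless: "d u < d v \<longleftrightarrow> v \<noteq> x \<and> (u = x \<or> cyc x u v)" if "u \<in> W" "v \<in> W" for u v
    using that M[of u] M[of v] M[of x] assms(2) by (auto simp: d_def cyc_def)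
  \<comment> \<open>Everything met before \<open>q\<close> lies in \<open>Z\<close>; the last such
    element is the required \<open>p\<close>.\<close>
  define P where "P = {w \<in> W. d w < d q}"
  have "finite P" "x \<in> P" using assms d0 by (auto simp: P_def)
  then have "Max (d ` P) \<in> d ` P" by (intro Max_in) auto
  then obtain p where p: "p \<in> P" "d p = Max (d ` P)" by auto
  have pmax: "d w \<le> d p" if "w \<in> P" for w
    unfolding p(2) using that \<open>finite P\<close> by simp
  have pZ: "p \<in> Z" using qmin[of p] p(1) by (auto simp: P_def)
  have pW: "p \<in> W" "d p < d q" using p(1) by (auto simp: P_def)
  have "\<not> cyc p w q" if w: "w \<in> W" for w
  proof
    assume c: "cyc p w q"
    have xp: "x = p \<or> cyc x p q"
      using dless[of p q] pW q(1) by auto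
    have "d p < d w \<and> d w < d q"
      using dless[of p w] dless[of w q] w pW q(1) xp c cyc_distinct[OF c] xq
        cyc_split[of x p q w] by (auto dest: cyc_distinct)
    then show False using pmax[of w] w by (auto simp: P_def)
  qed
  then have "(p, q) \<in> arcs W" using pW q pZ by (intro arcsI) auto
  then show ?thesis using that pZ q by blast
qed

lemma arcs_succ_ex:
  assumes "finite W" "x \<in> W" "y \<in> W" "x \<noteq> y"
  obtains q where "(x, q) \<in> arcs W"
  using arcs_leaving[of W x "{x}" y] assms by auto

lemma arcs_pred_ex:
  assumes "finite W" "x \<in> W" "y \<in> W" "x \<noteq> y"
  obtains q where "(q, x) \<in> arcs W"
  using arcs_leaving[of W y "-{x}" x] assms by auto

lemma arcs_asym:
  assumes "card W \<ge> 3" "(p, q) \<in> arcs W" shows "(q, p) \<notin> arcs W"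
proof
  assume "(q, p) \<in> arcs W"
  then have "W \<subseteq> {p, q}"
    using assms(2) not_cyc_iff[of p q] by (auto simp: arcs_def)
  then have "card W \<le> card {p, q}" by (intro card_mono) auto
  also have "\<dots> \<le> 2" by (simp add: card_insert_if)
  finally show False using assms by simp
qed

lemma card3_other:
  assumes "card W \<ge> 3" obtains w where "w \<in> W" "w \<noteq> p" "w \<noteq> q"
proof -
  have "\<not> W \<subseteq> {p, q}"
  proof
    assume "W \<subseteq> {p, q}"
    then have "card W \<le> card {p, q}" by (intro card_mono) auto
    also have "\<dots> \<le> 2" by (simp add: card_insert_if)
    finally show False using assms by simp
  qed
  then show ?thesis using that by auto
qed

text \<open>An arc of \<open>W\<close> that leaves \<open>B\<close> at \<open>p\<close> ends outside
  \<open>B\<close>, so the successor of \<open>p\<close> within \<open>B\<close> is a different one.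
  For polygons the new arc is a chord of \<open>W\<close>, and cutting along it brings
  \<open>W\<close> closer to \<open>B\<close>.\<close>

lemma arcs_new:
  assumes "finite W" "card B \<ge> 3" "B \<subseteq> W" "B \<noteq> W"
  obtains p q where "(p, q) \<in> arcs B" "(p, q) \<notin> arcs W"
proof -
  obtain x where x: "x \<in> W" "x \<notin> B" using assms by auto
  obtain y where y: "y \<in> B" using assms(2) by (metis card.empty ex_in_conv not_numeral_le_zero)
  obtain p r where pr: "(p, r) \<in> arcs W" "p \<in> B" "r \<notin> B"
    using arcs_leaving[OF assms(1), of y B x] x y assms by blast
  obtain z where "z \<in> B" "z \<noteq> p" using card3_other[OF assms(2)] by blast
  then obtain q where q: "(p, q) \<in> arcs B"
    using arcs_succ_ex[of B p z] pr assms finite_subset by metis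
  have "(p, q) \<notin> arcs W" using arcs_succ_unique[OF pr(1)] pr(3) arcsD(2)[OF q] by blast
  then show ?thesis using that q by blast
qed

lemma half_subset: "half W p q \<subseteq> W" by (auto simp: half_def)

lemma half_mem [simp]: "p \<in> half W p q \<longleftrightarrow> p \<in> W" "q \<in> half W p q \<longleftrightarrow> q \<in> W"
  by (auto simp: half_def cyc_def)

lemma half_Un: "p \<noteq> q \<Longrightarrow> half W p q \<union> half W q p = W"
  by (auto simp: half_def cyc_def)

lemma half_Int: "p \<noteq> q \<Longrightarrow> p \<in> W \<Longrightarrow> q \<in> W \<Longrightarrow> half W p q \<inter> half W q p = {p, q}"
  by (auto simp: half_def cyc_def)

lemma half_arc: "p \<in> W \<Longrightarrow> q \<in> W \<Longrightarrow> p \<noteq> q \<Longrightarrow> (p, q) \<in> arcs (half W p q)"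
  by (auto simp: half_def arcs_def cyc_def)

text \<open>Walking from the common point \<open>w\<close> in either direction, the first end point
  reached belongs to both open circular arcs, since neither contains an end of the other.\<close>

lemma cyc_cross_eq:
  assumes "cyc u w v" "cyc p w q" "\<not> cyc p u q" "\<not> cyc p v q" "\<not> cyc u p v" "\<not> cyc u q v"
  shows "u = p \<and> v = q"
  using assms unfolding cyc_def by (smt (verit, best) nat_neq_iff order_less_trans)

lemma arcs_half_subset:
  assumes "p \<in> W" "q \<in> W" "p \<noteq> q"
  shows "arcs (half W p q) \<subseteq> insert (p, q) (arcs W)"
proof clarify
  fix u v assume a: "(u, v) \<in> arcs (half W p q)" and n: "(u, v) \<notin> arcs W"
  then obtain w where w: "w \<in> W" "cyc u w v" and uv: "\<not> cyc p u q" "\<not> cyc p v q"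
    by (auto simp: arcs_def half_def)
  have wc: "cyc p w q" using a w by (auto simp: arcs_def half_def)
  have "p \<in> half W p q" "q \<in> half W p q" using assms by simp_all
  then have "\<not> cyc u p v" "\<not> cyc u q v" using a by (auto simp: arcs_def)
  then show "u = p \<and> v = q"
    using cyc_cross_eq[OF w(2) wc uv] by blast
qed

section \<open>Biclosed sets of polygons\<close>

locale outerplanar =
  fixes V :: "nat set" and E :: "(nat \<times> nat) set"
  assumes finite_V: "finite V"
    and E_V: "(u, v) \<in> E \<Longrightarrow> u \<in> V"
    and E_sym: "(u, v) \<in> E \<Longrightarrow> (v, u) \<in> E"
    and E_irrefl: "(u, v) \<in> E \<Longrightarrow> u \<noteq> v"
    and E_nocross: "(p, q) \<in> E \<Longrightarrow> (r, s) \<in> E \<Longrightarrow> cyc p r q \<Longrightarrow> \<not> cyc q s p"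
begin

definition polygon :: "nat set \<Rightarrow> bool" where
  "polygon W \<longleftrightarrow> W \<subseteq> V \<and> 3 \<le> card W \<and> arcs W \<subseteq> E"

definition chord :: "nat set \<Rightarrow> nat \<Rightarrow> nat \<Rightarrow> bool" where
  "chord W p q \<longleftrightarrow> p \<in> W \<and> q \<in> W \<and> (p, q) \<in> E \<and> (p, q) \<notin> arcs W \<and> (q, p) \<notin> arcs W"

lemma polygon_finite: "polygon W \<Longrightarrow> finite W"
  using finite_V finite_subset by (auto simp: polygon_def)

lemma chord_sym: "chord W p q \<Longrightarrow> chord W q p"
  using E_sym by (auto simp: chord_def)

lemma chord_neq: "chord W p q \<Longrightarrow> p \<noteq> q"
  using E_irrefl by (auto simp: chord_def)

lemma chord_between:
  assumes "chord W p q" obtains w where "w \<in> W" "cyc p w q"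
  using assms chord_neq[OF assms] by (auto simp: chord_def arcs_def)

lemma card_half:
  assumes "finite W" "p \<in> W" "q \<in> W" "p \<noteq> q"
  shows "card (half W p q) + card (half W q p) = card W + 2"
  using card_Un_Int[of "half W p q" "half W q p"] half_Un[of p q W] half_Int[of p q W] assms
    finite_subset[OF half_subset] by (auto simp: card_insert_if)

lemma chord_half_card:
  assumes "finite W" "chord W p q"
  shows "3 \<le> card (half W p q)"
proof -
  obtain w where w: "w \<in> W" "cyc q w p" using chord_between[OF chord_sym[OF assms(2)]] by blast
  have "{p, q, w} \<subseteq> half W p q"
    using w assms(2) not_cyc_iff[of p q w] chord_neq[OF assms(2)]
    by (auto simp: chord_def half_def cyc_def)
  then have "card {p, q, w} \<le> card (half W p q)"
    using assms(1) finite_subset[OF half_subset] by (intro card_mono) auto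
  then show ?thesis using w chord_neq[OF assms(2)] by (auto dest!: cyc_distinct)
qed

lemma chord_half_polygon:
  assumes "polygon W" "chord W p q"
  shows "polygon (half W p q)"
  using assms chord_half_card[OF polygon_finite] arcs_half_subset[of p W q] chord_neq[OF assms(2)]
    half_subset[of W p q] by (auto simp: polygon_def chord_def)

lemma chord_half_psubset:
  assumes "chord W p q" shows "half W p q \<subset> W"
  using chord_between[OF assms] half_subset[of W p q] by (auto simp: half_def)

lemma polygon_arc_notin_chord:
  assumes "polygon B" "B \<subseteq> W" "(p, q) \<in> arcs B" "(p, q) \<notin> arcs W"
  shows "chord W p q"
proof -
  have "(q, p) \<notin> arcs W"
    using arcs_subset[of q p W B] arcs_asym[of B p q] assms arcsD(1,2)[OF assms(3)]
    by (auto simp: polygon_def)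
  then show ?thesis using assms arcsD(1,2)[OF assms(3)] by (auto simp: chord_def polygon_def)
qed

lemma arc_subset_half: "(p, q) \<in> arcs B \<Longrightarrow> B \<subseteq> W \<Longrightarrow> B \<subseteq> half W p q"
  by (auto simp: half_def arcs_def)

lemma chord_in_half:
  assumes "chord W r s" "r \<in> half W p q" "s \<in> half W p q" "p \<in> W" "q \<in> W" "p \<noteq> q"
    "(r, s) \<noteq> (p, q)" "(s, r) \<noteq> (p, q)"
  shows "chord (half W p q) r s"
  using assms arcs_half_subset[of p W q] by (auto simp: chord_def)

definition closed :: "nat set set \<Rightarrow> bool" where
  "closed P \<longleftrightarrow> (\<forall>W p q. polygon W \<longrightarrow> chord W p q \<longrightarrow> half W p q \<in> P \<longrightarrow> half W q p \<in> P \<longrightarrow> W \<in> P)"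

definition coclosed :: "nat set set \<Rightarrow> bool" where
  "coclosed P \<longleftrightarrow> (\<forall>W\<in>P. \<forall>p q. chord W p q \<longrightarrow> half W p q \<in> P \<or> half W q p \<in> P)"

definition biclosed :: "nat set set \<Rightarrow> bool" where
  "biclosed P \<longleftrightarrow> P \<subseteq> Collect polygon \<and> closed P \<and> coclosed P"

lemma biclosed_compl:
  assumes "biclosed P" shows "biclosed (Collect polygon - P)"
  using assms chord_half_polygon chord_sym
  unfolding biclosed_def closed_def coclosed_def by blast

text \<open>\<open>B\<close> is enlarged to \<open>W\<close> by gluing on the pieces of
  \<open>W\<close> behind the arcs of \<open>B\<close>, one at a time; each piece has to be in
  \<open>P\<close>. The induction undoes the last gluing: it cuts off one piece and treats the rest
  \<open>H\<close>.\<close>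

lemma closed_fill:
  assumes "closed P" "polygon B" "B \<in> P"
  shows "polygon W \<Longrightarrow> B \<subseteq> W \<Longrightarrow>
    (\<And>p q. (p, q) \<in> arcs B \<Longrightarrow> (p, q) \<notin> arcs W \<Longrightarrow> half W q p \<in> P) \<Longrightarrow> W \<in> P"
proof (induction "card W" arbitrary: W rule: less_induct)
  case less
  show ?case
  proof (cases "B = W")
    case True then show ?thesis using assms by simp
  next
    case False
    then obtain p q where pq: "(p, q) \<in> arcs B" "(p, q) \<notin> arcs W"
      using arcs_new[of W B] polygon_finite less.prems assms(2) by (auto simp: polygon_def)
    have ch: "chord W p q"
      using polygon_arc_notin_chord[OF assms(2) less.prems(2) pq] .
    define H where "H = half W p q"
    have H: "polygon H" "B \<subseteq> H" "H \<subset> W"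
      using chord_half_polygon[OF less.prems(1) ch] arc_subset_half[OF pq(1) less.prems(2)]
        chord_half_psubset[OF ch] by (auto simp: H_def)
    have "H \<in> P"
    proof (rule less.hyps)
      show "card H < card W" using H polygon_finite[OF less.prems(1)] psubset_card_mono by blast
    next
      fix p' q' assume a: "(p', q') \<in> arcs B" "(p', q') \<notin> arcs H"
      have nW: "(p', q') \<notin> arcs W"
        using a(2) arcs_subset[of p' q' W H] arcsD(1,2)[OF a(1)] H by blast
      have ne: "(p', q') \<noteq> (p, q)" using a(2) half_arc[of p W q] ch chord_neq[OF ch]
        by (auto simp: H_def chord_def)
      \<comment> \<open>The pieces behind different arcs of \<open>B\<close> have disjoint
        interiors, so cutting off one leaves the others unchanged.\<close>
      have "half H q' p' = half W q' p'"
      proof -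
        have "\<not> cyc p w q" if w: "w \<in> W" "\<not> cyc q' w p'" for w
        proof
          assume c: "cyc p w q"
          have "w \<notin> B" using c pq(1) by (auto simp: arcs_def)
          then have "cyc p' w q'"
            using w(2) not_cyc_iff[of q' p' w] arcsD(1-3)[OF a(1)] by auto
          then show False
            using cyc_cross_eq[OF _ c, of p' q'] ne arcsD(4)[OF pq(1)] arcsD(4)[OF a(1)]
              arcsD(1,2)[OF pq(1)] arcsD(1,2)[OF a(1)] by auto
        qed
        then show ?thesis by (auto simp: half_def H_def)
      qed
      then show "half H q' p' \<in> P" using less.prems(3)[OF a(1) nW] by simp
    qed (use H in auto)
    then show ?thesis using assms(1) ch less.prems(1) less.prems(3)[OF pq]
      by (auto simp: closed_def H_def)
  qed
qed

section \<open>The closed set generated by a coclosed set\<close>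

inductive_set join_closure :: "nat set set \<Rightarrow> nat set set" for P where
  base: "X \<in> P \<Longrightarrow> X \<in> join_closure P"
| join: "polygon X \<Longrightarrow> chord X p q \<Longrightarrow> half X p q \<in> join_closure P \<Longrightarrow>
    half X q p \<in> join_closure P \<Longrightarrow> X \<in> join_closure P"

lemma join_closure_closed: "closed (join_closure P)"
  unfolding closed_def using join_closure.join by blast

text \<open>Chords do not cross, so \<open>(r, s)\<close> splits one half of \<open>(p, q)\<close> and leaves the other half intact;
  the induction hypothesis for that half decides which half of \<open>(r, s)\<close> is generated.\<close>
lemma join_closure_nested:
  assumes X: "polygon X" and pq: "chord X p q" and rs: "chord X r s"
    and ne: "(r, s) \<noteq> (p, q)" "(r, s) \<noteq> (q, p)"
    and rsH: "r \<in> half X p q" "s \<in> half X p q"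
    and pqH: "p \<in> half X s r" "q \<in> half X s r"
    and jc: "half X q p \<in> join_closure P"
    and IH: "\<And>r s. chord (half X p q) r s \<Longrightarrow>
      half (half X p q) r s \<in> join_closure P \<or> half (half X p q) s r \<in> join_closure P"
  shows "half X r s \<in> join_closure P \<or> half X s r \<in> join_closure P"
proof -
  have X4: "p \<in> X" "q \<in> X" "r \<in> X" "s \<in> X" "p \<noteq> q" "r \<noteq> s"
    using pq rs chord_neq by (auto simp: chord_def)
  have key: "\<not> cyc s w r" if "cyc p w q" for w
    using cyc_cross_eq[OF _ that, of s r] rsH pqH ne by (auto simp: half_def)
  have "chord (half X p q) r s"
    using chord_in_half[OF rs rsH] X4 ne by auto
  from IH[OF this] show ?thesis
  proof
    have "half (half X p q) r s = half X r s"
      using key not_cyc_iff[of r s] X4 rsH by (auto simp: half_def)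
    then show "half (half X p q) r s \<in> join_closure P \<Longrightarrow> ?thesis" by simp
  next
    assume h: "half (half X p q) s r \<in> join_closure P"
    have sr: "chord X s r" using rs chord_sym by blast
    have "chord (half X s r) p q"
      using chord_in_half[OF pq pqH] X4 ne by auto
    moreover have "half (half X s r) p q = half (half X p q) s r"
      by (auto simp: half_def)
    moreover have "half (half X s r) q p = half X q p"
      using key not_cyc_iff[of q p] X4 pqH by (auto simp: half_def)
    ultimately have "half X s r \<in> join_closure P"
      using join_closure.join[OF chord_half_polygon[OF X sr], of p q P] h jc by simp
    then show ?thesis by simp
  qed
qed

lemma same_side:
  assumes "(p, q) \<in> E" "(r, s) \<in> E" "r \<in> X" "s \<in> X"
  shows "r \<in> half X p q \<and> s \<in> half X p q \<or> r \<in> half X q p \<and> s \<in> half X q p"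
  using E_nocross[OF assms(1,2)] E_nocross[OF assms(1) E_sym[OF assms(2)]] assms
    not_cyc_iff[OF E_irrefl[OF assms(1)], of r] not_cyc_iff[OF E_irrefl[OF assms(1)], of s]
    not_cyc_iff[OF E_irrefl[OF E_sym[OF assms(1)]], of r]
    not_cyc_iff[OF E_irrefl[OF E_sym[OF assms(1)]], of s]
  unfolding half_def by blast

lemma chord_same_side:
  assumes "chord X p q" "chord X r s"
  shows "r \<in> half X p q \<and> s \<in> half X p q \<or> r \<in> half X q p \<and> s \<in> half X q p"
  using same_side[of p q r s X] assms by (simp add: chord_def)

text \<open>Induction over the generation. The chord along which a set was joined has both halves
  generated; any other chord lies on one side of it, and \<open>join_closure_nested\<close> applies
  after possibly swapping the ends of the two chords.\<close>

lemma join_closure_coclosed: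
  assumes "coclosed P"
  shows "coclosed (join_closure P)"
proof -
  have "chord X r s \<Longrightarrow> half X r s \<in> join_closure P \<or> half X s r \<in> join_closure P"
    if "X \<in> join_closure P" for X r s
    using that
  proof (induction arbitrary: r s rule: join_closure.induct)
    case (base X)
    then show ?case using assms unfolding coclosed_def by (blast intro: join_closure.base)
  next
    case (join X p q)
    note qp = chord_sym[OF join.hyps(2)]
    note sr = chord_sym[OF join.prems]
    note n1 = join_closure_nested[OF join.hyps(1,2) _ _ _ _ _ _ _ join.hyps(4) join.IH(1)]
    note n2 = join_closure_nested[OF join.hyps(1) qp _ _ _ _ _ _ _ join.hyps(3) join.IH(2)]
    show ?case
    proof (cases "(r, s) = (p, q) \<or> (r, s) = (q, p)")
      case True then show ?thesis using join.hyps by auto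
    next
      case False
      show ?thesis
        using chord_same_side[OF join.hyps(2) join.prems] chord_same_side[OF sr join.hyps(2)]
          n1[OF join.prems] n1[OF sr] n2[OF join.prems] n2[OF sr] False by blast
    qed
  qed
  then show ?thesis unfolding coclosed_def by blast
qed

text \<open>A set of \<open>N\<close> that is cut by a chord has a half in \<open>N\<close>, so a
  join of two sets outside \<open>N\<close> stays outside.\<close>

lemma join_closure_disjoint:
  assumes "coclosed N" "P \<inter> N = {}" shows "join_closure P \<inter> N = {}"
proof -
  have "X \<notin> N" if "X \<in> join_closure P" for X
    using that by induction (use assms in \<open>auto simp: coclosed_def\<close>)
  then show ?thesis by blast
qed

lemma join_closure_polygon:
  assumes "P \<subseteq> Collect polygon" shows "join_closure P \<subseteq> Collect polygon"
proof
  fix X assume "X \<in> join_closure P" then show "X \<in> Collect polygon"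
    by induction (use assms in auto)
qed

end

section \<open>Maximal separated collections\<close>

context outerplanar begin

definition total :: "(nat \<times> nat) set \<Rightarrow> bool" where
  "total X \<longleftrightarrow> X \<subseteq> E \<and> (\<forall>(u, v)\<in>E. (u, v) \<in> X \<longleftrightarrow> (v, u) \<notin> X)"

definition separated :: "(nat \<times> nat) set \<Rightarrow> (nat \<times> nat) set \<Rightarrow> bool" where
  "separated X Y \<longleftrightarrow> (\<forall>W. polygon W \<longrightarrow>
     \<not> (arcs W \<subseteq> X \<and> (arcs W)\<inverse> \<subseteq> Y) \<and> \<not> ((arcs W)\<inverse> \<subseteq> X \<and> arcs W \<subseteq> Y))"

definition collection :: "(nat \<times> nat) set set \<Rightarrow> bool" where
  "collection S \<longleftrightarrow> (\<forall>X\<in>S. total X) \<and> (\<forall>X\<in>S. \<forall>Y\<in>S. X \<noteq> Y \<longrightarrow> separated X Y)"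

definition compatible :: "nat set set \<Rightarrow> (nat \<times> nat) set set" where
  "compatible P = {X. total X \<and>
     (\<forall>W. polygon W \<longrightarrow> (arcs W \<subseteq> X \<longrightarrow> W \<in> P) \<and> ((arcs W)\<inverse> \<subseteq> X \<longrightarrow> W \<notin> P))}"

lemma polygon_arcs_nonempty:
  assumes "polygon W" obtains p q where "(p, q) \<in> arcs W"
proof -
  have 3: "3 \<le> card W" using assms by (auto simp: polygon_def)
  obtain x where "x \<in> W" using card3_other[OF 3] by metis
  moreover obtain y where "y \<in> W" "y \<noteq> x" using card3_other[OF 3] by metis
  ultimately show ?thesis using arcs_succ_ex[OF polygon_finite[OF assms], of x y] that by metis
qed

lemma total_converse: "total X \<Longrightarrow> total (X\<inverse>)"
  using E_sym by (auto simp: total_def)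

lemma total_not_both:
  assumes "total X" "polygon W" "arcs W \<subseteq> X" shows "\<not> (arcs W)\<inverse> \<subseteq> X"
proof -
  obtain p q where "(p, q) \<in> arcs W" using polygon_arcs_nonempty[OF assms(2)] .
  moreover from this have "(p, q) \<in> X" "(p, q) \<in> E" using assms by (auto simp: polygon_def)
  ultimately show ?thesis using assms(1) by (auto simp: total_def)
qed

lemma collection_compatible: "collection (compatible P)"
proof -
  have "separated X Y" if X: "X \<in> compatible P" and Y: "Y \<in> compatible P" for X Y
    unfolding separated_def
  proof (intro allI impI)
    fix W assume "polygon W"
    then show "\<not> (arcs W \<subseteq> X \<and> (arcs W)\<inverse> \<subseteq> Y) \<and> \<not> ((arcs W)\<inverse> \<subseteq> X \<and> arcs W \<subseteq> Y)"
      using X Y unfolding compatible_def by blast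
  qed
  then show ?thesis by (simp add: collection_def) (simp add: compatible_def)
qed

lemma compatible_converse:
  "X \<in> compatible P \<Longrightarrow> X\<inverse> \<in> compatible (Collect polygon - P)"
  using total_converse unfolding compatible_def by (auto simp: converse_subset_swap)

text \<open>Since the chord is oriented one way or the other, it closes the path on one of its sides
  to a directed cycle.\<close>

lemma half_directed:
  assumes "total X" "chord W p q" "arcs W \<subseteq> X"
  shows "arcs (half W p q) \<subseteq> X \<or> arcs (half W q p) \<subseteq> X"
proof -
  have "(p, q) \<in> X \<or> (q, p) \<in> X" using assms by (auto simp: total_def chord_def)
  then show ?thesis
    using arcs_half_subset[of p W q] arcs_half_subset[of q W p] assms(2,3) chord_neq[OF assms(2)]
    by (auto simp: chord_def)
qed

text \<open>Coclosedness is used twice: for \<open>P\<close> it makes the join closure biclosed, for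
  \<open>N\<close> it keeps the join closure away from the polygons directed the other way.\<close>

lemma collection_extends:
  assumes "collection S" obtains P where "biclosed P" "S \<subseteq> compatible P"
proof -
  define P where "P = {W. polygon W \<and> (\<exists>X\<in>S. arcs W \<subseteq> X)}"
  define N where "N = {W. polygon W \<and> (\<exists>X\<in>S. arcs W \<subseteq> X\<inverse>)}"
  have tot: "total X" if "X \<in> S" for X using assms that by (auto simp: collection_def)
  have "coclosed P"
    unfolding coclosed_def
  proof (intro ballI allI impI)
    fix W p q assume W: "W \<in> P" and ch: "chord W p q"
    then obtain X where X: "X \<in> S" "arcs W \<subseteq> X" "polygon W" by (auto simp: P_def)
    show "half W p q \<in> P \<or> half W q p \<in> P"
      using half_directed[OF tot[OF X(1)] ch X(2)] X(1) chord_half_polygon[OF X(3) ch]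
        chord_half_polygon[OF X(3) chord_sym[OF ch]] by (auto simp: P_def)
  qed
  have "coclosed N"
    unfolding coclosed_def
  proof (intro ballI allI impI)
    fix W p q assume W: "W \<in> N" and ch: "chord W p q"
    then obtain X where X: "X \<in> S" "arcs W \<subseteq> X\<inverse>" "polygon W" by (auto simp: N_def)
    have "arcs (half W p q) \<subseteq> X\<inverse> \<or> arcs (half W q p) \<subseteq> X\<inverse>"
      using half_directed[OF total_converse[OF tot[OF X(1)]] ch X(2)] .
    then show "half W p q \<in> N \<or> half W q p \<in> N"
      using X(1) chord_half_polygon[OF X(3) ch] chord_half_polygon[OF X(3) chord_sym[OF ch]]
      by (auto simp: N_def)
  qed
  have "P \<inter> N = {}"
  proof -
    have False if "polygon W" "X \<in> S" "arcs W \<subseteq> X" "Y \<in> S" "(arcs W)\<inverse> \<subseteq> Y" for W X Y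
    proof (cases "X = Y")
      case True then show ?thesis using total_not_both[OF tot] that by blast
    next
      case False then show ?thesis using assms that unfolding collection_def separated_def by blast
    qed
    then show ?thesis by (auto simp: P_def N_def converse_subset_swap)
  qed
  define Q where "Q = join_closure P"
  have "biclosed Q"
    unfolding biclosed_def Q_def
    using join_closure_polygon[of P] join_closure_closed join_closure_coclosed[OF \<open>coclosed P\<close>]
    by (auto simp: P_def)
  moreover have "S \<subseteq> compatible Q"
  proof
    fix X assume X: "X \<in> S"
    have "W \<in> Q" if "polygon W" "arcs W \<subseteq> X" for W
      using X that by (auto simp: Q_def P_def intro!: join_closure.base)
    moreover have "W \<notin> Q" if "polygon W" "(arcs W)\<inverse> \<subseteq> X" for W
      using X that join_closure_disjoint[OF \<open>coclosed N\<close> \<open>P \<inter> N = {}\<close>]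
      by (auto simp: Q_def N_def converse_subset_swap)
    ultimately show "X \<in> compatible Q" using tot[OF X] by (auto simp: compatible_def)
  qed
  ultimately show ?thesis using that by blast
qed

text \<open>At a minimal polygon \<open>W\<close> distinguishing two biclosed sets, every chord of \<open>W\<close> has exactly one
  half in \<open>P\<close>, and orienting the chord along that half is forced. Edges leaving \<open>W\<close> and the
  increasing orientation outside of \<open>W\<close> allow no further directed cycles.\<close>
lemma compatible_witness:
  assumes P: "biclosed P" and Q: "biclosed Q" and W: "polygon W" "W \<in> P" "W \<notin> Q"
    and min: "\<And>B. polygon B \<Longrightarrow> B \<subset> W \<Longrightarrow> B \<in> P \<longleftrightarrow> B \<in> Q"
  obtains X where "X \<in> compatible P" "arcs W \<subseteq> X"
proof -
  have one: "half W p q \<in> P \<longleftrightarrow> half W q p \<notin> P" if ch: "chord W p q" for p q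
  proof -
    note qp = chord_sym[OF ch]
    have "half W p q \<in> P \<longleftrightarrow> half W p q \<in> Q" "half W q p \<in> P \<longleftrightarrow> half W q p \<in> Q"
      using min[OF chord_half_polygon[OF W(1)] chord_half_psubset] ch qp by simp_all
    moreover have "half W p q \<in> P \<or> half W q p \<in> P"
      using P W(2) ch by (simp add: biclosed_def coclosed_def)
    moreover have "\<not> (half W p q \<in> Q \<and> half W q p \<in> Q)"
      using Q W(1,3) ch unfolding biclosed_def closed_def by metis
    ultimately show ?thesis by blast
  qed
  define X where "X = {(p, q) \<in> E. (p, q) \<in> arcs W \<or> (chord W p q \<and> half W p q \<in> P) \<or>
    (p \<in> W \<and> q \<notin> W) \<or> (p \<notin> W \<and> q \<notin> W \<and> p < q)}"
  have arcsX: "arcs W \<subseteq> X" using W(1) by (auto simp: X_def polygon_def)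
  have 3: "3 \<le> card W" using W(1) by (simp add: polygon_def)
  have tot: "total X"
    unfolding total_def
  proof (intro conjI, force simp: X_def, clarify)
    fix u v assume uv: "(u, v) \<in> E"
    note vu = E_sym[OF uv] and ne = E_irrefl[OF uv]
    show "(u, v) \<in> X \<longleftrightarrow> (v, u) \<notin> X"
    proof (cases "u \<in> W \<and> v \<in> W")
      case True
      consider "(u, v) \<in> arcs W" | "(v, u) \<in> arcs W" | "chord W u v"
        using True uv by (auto simp: chord_def)
      then show ?thesis
        using True arcs_asym[OF 3, of u v] arcs_asym[OF 3, of v u] one[of u v] chord_sym[of W u v] uv vu
        by cases (auto simp: X_def chord_def)
    next
      case False
      then show ?thesis using uv vu ne arcsD(1,2)[of u v W] arcsD(1,2)[of v u W]
        by (auto simp: X_def chord_def)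
    qed
  qed
  have sub: "B \<subseteq> W" if B: "polygon B" and d: "arcs B \<subseteq> X \<or> (arcs B)\<inverse> \<subseteq> X" for B
  proof (rule ccontr)
    assume "\<not> B \<subseteq> W"
    then obtain b where b: "b \<in> B" "b \<notin> W" by blast
    have fin: "finite B" using polygon_finite[OF B] .
    have noin: "(u, v) \<notin> X" if "u \<notin> W" "v \<in> W" for u v
      using that by (auto simp: X_def arcs_def chord_def)
    have dis: "B \<inter> W = {}"
    proof (rule ccontr)
      assume "B \<inter> W \<noteq> {}"
      then obtain c where c: "c \<in> B" "c \<in> W" by blast
      obtain p q where "(p, q) \<in> arcs B" "p \<in> W" "q \<notin> W"
        using arcs_leaving[OF fin c b] .
      moreover obtain r s where "(r, s) \<in> arcs B" "r \<in> -W" "s \<notin> -W"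
        using arcs_leaving[OF fin, of b "-W" c] b c by blast
      ultimately show False using d noin by auto
    qed
    have inc: "u < v" if "u \<notin> W" "(u, v) \<in> X" for u v
      using that by (auto simp: X_def arcs_def chord_def)
    \<comment> \<open>In an increasing orientation the edges at the largest vertex all point to it,
      so no directed cycle passes through it.\<close>
    define m where "m = Max B"
    have m: "m \<in> B" using b Max_in[OF fin] by (auto simp: m_def)
    have m_max: "x \<le> m" if "x \<in> B" for x using that fin by (simp add: m_def)
    obtain y where y: "y \<in> B" "y \<noteq> m" using card3_other[of B m m] B by (auto simp: polygon_def)
    obtain q where q: "(m, q) \<in> arcs B" using arcs_succ_ex[OF fin m y(1)] y by metis
    obtain r where r: "(r, m) \<in> arcs B" using arcs_pred_ex[OF fin m y(1)] y by metis
    show False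
      using q r d inc[of m q] inc[of m r] m_max[OF arcsD(2)[OF q]] m_max[OF arcsD(1)[OF r]] dis m
      by auto
  qed
  have "X \<in> compatible P"
    unfolding compatible_def
  proof (intro CollectI conjI allI impI tot)
    fix B assume B: "polygon B" and d: "arcs B \<subseteq> X"
    have BW: "B \<subseteq> W" using sub B d by blast
    show "B \<in> P"
    proof (rule ccontr)
      assume n: "B \<notin> P"
      \<comment> \<open>Each arc of \<open>B\<close> that is a chord of \<open>W\<close> points
        along \<open>B\<close>, so its half containing \<open>B\<close> is in \<open>P\<close> and
        the outer piece is not. Filling up \<open>B\<close> then takes place entirely in the
        complement of \<open>P\<close>.\<close>
      have "W \<in> Collect polygon - P"
      proof (rule closed_fill[OF _ B _ W(1) BW])
        show "closed (Collect polygon - P)"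
          using biclosed_compl[OF P] by (simp add: biclosed_def)
        show "B \<in> Collect polygon - P" using B n by simp
        fix p q assume a: "(p, q) \<in> arcs B" "(p, q) \<notin> arcs W"
        have ch: "chord W p q" using polygon_arc_notin_chord[OF B BW a] .
        have "half W p q \<in> P" using a d arcsD(1,2)[OF a(1)] BW by (auto simp: X_def)
        then show "half W q p \<in> Collect polygon - P"
          using one[OF ch] chord_half_polygon[OF W(1) chord_sym[OF ch]] by simp
      qed
      then show False using W by simp
    qed
  next
    fix B assume B: "polygon B" and d: "(arcs B)\<inverse> \<subseteq> X"
    have BW: "B \<subseteq> W" using sub B d by blast
    show "B \<notin> P"
    proof
      assume BP: "B \<in> P"
      have neq: "B \<noteq> W" using total_not_both[OF tot W(1) arcsX] d by auto
      \<comment> \<open>Now the chords point against \<open>B\<close>, so the outer pieces are in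
        \<open>P\<close>. They and \<open>B\<close> are proper subsets of \<open>W\<close>, hence
        also in \<open>Q\<close>, and filling up leads to \<open>W\<close> in
        \<open>Q\<close>.\<close>
      have "W \<in> Q"
      proof (rule closed_fill[OF _ B _ W(1) BW])
        show "closed Q" using Q by (simp add: biclosed_def)
        show "B \<in> Q" using min[OF B] neq BW BP by auto
        fix p q assume a: "(p, q) \<in> arcs B" "(p, q) \<notin> arcs W"
        have ch: "chord W p q" using polygon_arc_notin_chord[OF B BW a] .
        note qp = chord_sym[OF ch]
        have "half W q p \<in> P" using a d arcsD(1,2)[OF a(1)] BW qp by (auto simp: X_def chord_def)
        then show "half W q p \<in> Q"
          using min[OF chord_half_polygon[OF W(1) qp] chord_half_psubset[OF qp]] by simp
      qed
      then show False using W by simp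
    qed
  qed
  then show ?thesis using arcsX that by blast
qed

lemma compatible_subset_imp_eq:
  assumes P: "biclosed P" and Q: "biclosed Q" and sub: "compatible P \<subseteq> compatible Q"
  shows "P = Q"
proof (rule ccontr)
  assume "P \<noteq> Q"
  then have "\<exists>W. polygon W \<and> (W \<in> P) \<noteq> (W \<in> Q)"
    using P Q by (auto simp: biclosed_def)
  then obtain W where W: "polygon W" "(W \<in> P) \<noteq> (W \<in> Q)"
    and least: "\<And>B. polygon B \<and> (B \<in> P) \<noteq> (B \<in> Q) \<Longrightarrow> card W \<le> card B"
    using ex_has_least_nat[of "\<lambda>W. polygon W \<and> (W \<in> P) \<noteq> (W \<in> Q)" _ card] by blast
  have min: "(B \<in> P) = (B \<in> Q)" if "polygon B" "B \<subset> W" for B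
    using least[of B] psubset_card_mono[OF polygon_finite[OF W(1)] that(2)] that by auto
  show False
  proof (cases "W \<in> P")
    case True
    then obtain X where "X \<in> compatible P" "arcs W \<subseteq> X"
      using compatible_witness[OF P Q W(1)] W(2) min by blast
    then show False using sub W True by (auto simp: compatible_def)
  next
    \<comment> \<open>Taking complements of biclosed sets corresponds to reversing orientations and
      exchanges the two cases.\<close>
    case False
    then obtain X where X: "X \<in> compatible (Collect polygon - P)" "arcs W \<subseteq> X"
      using compatible_witness[OF biclosed_compl[OF P] biclosed_compl[OF Q] W(1)] W min by blast
    have "Collect polygon - (Collect polygon - P) = P" using P by (auto simp: biclosed_def)
    then have "X\<inverse> \<in> compatible P" using compatible_converse[OF X(1)] by simp
    then have "X\<inverse> \<in> compatible Q" using sub by blast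
    then show False using X(2) W False by (auto simp: compatible_def)
  qed
qed

lemma maximal_collections_bij:
  "bij_betw compatible {P. biclosed P} {S. collection S \<and> (\<forall>S'. collection S' \<and> S \<subseteq> S' \<longrightarrow> S' = S)}"
proof (rule bij_betw_imageI)
  show "inj_on compatible {P. biclosed P}"
    using compatible_subset_imp_eq by (intro inj_onI) simp
  show "compatible ` {P. biclosed P} =
    {S. collection S \<and> (\<forall>S'. collection S' \<and> S \<subseteq> S' \<longrightarrow> S' = S)}"
  proof (intro subset_antisym subsetI)
    fix S assume "S \<in> compatible ` {P. biclosed P}"
    then obtain P where P: "biclosed P" "S = compatible P" by blast
    have "S' = S" if S': "collection S'" "S \<subseteq> S'" for S'
    proof -
      obtain Q where Q: "biclosed Q" "S' \<subseteq> compatible Q" using collection_extends[OF S'(1)] .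
      then have "P = Q" using compatible_subset_imp_eq[OF P(1) Q(1)] S'(2) P(2) by simp
      then show ?thesis using S' P Q by blast
    qed
    then show "S \<in> {S. collection S \<and> (\<forall>S'. collection S' \<and> S \<subseteq> S' \<longrightarrow> S' = S)}"
      using collection_compatible P by simp
  next
    fix S assume S: "S \<in> {S. collection S \<and> (\<forall>S'. collection S' \<and> S \<subseteq> S' \<longrightarrow> S' = S)}"
    then obtain P where "biclosed P" "S \<subseteq> compatible P" using collection_extends[of S] by blast
    then show "S \<in> compatible ` {P. biclosed P}"
      using S collection_compatible[of P] by blast
  qed
qed

end

section \<open>Cycles of an outerplanar graph\<close>

definition cyc_arcs :: "nat list \<Rightarrow> (nat \<times> nat) set" where
  "cyc_arcs vs = {(vs ! i, vs ! ((i + 1) mod length vs)) | i. i < length vs}"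

lemma directed_along_iff: "directed_along X vs \<longleftrightarrow> cyc_arcs vs \<subseteq> X"
  by (auto simp: directed_along_def cyc_arcs_def)

lemma cyc_arcs_rev_subset: "cyc_arcs (rev vs) \<subseteq> (cyc_arcs vs)\<inverse>"
proof clarsimp
  fix x y assume "(x, y) \<in> cyc_arcs (rev vs)"
  then obtain i where i: "i < length vs" "x = rev vs ! i" "y = rev vs ! ((i + 1) mod length vs)"
    by (auto simp: cyc_arcs_def)
  define n where "n = length vs"
  show "(y, x) \<in> cyc_arcs vs"
  proof (cases "i + 1 < n")
    case True
    \<comment> \<open>Edge \<open>i\<close> of the reversed list is edge \<open>n - 2 - i\<close> of
      \<open>vs\<close> backwards; only the closing edge, at index \<open>n - 1\<close>, keeps its
      place.\<close>
    define k where "k = n - 2 - i"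
    have "x = vs ! (k + 1)" "y = vs ! k"
      using i True by (auto simp: n_def k_def rev_nth intro!: arg_cong[of _ _ "(!) vs"])
    moreover have "k + 1 < n" using True by (auto simp: k_def)
    ultimately show ?thesis
      by (auto simp: cyc_arcs_def n_def intro!: exI[of _ k])
  next
    case False
    then have "i = n - 1" "0 < n" using i by (auto simp: n_def)
    then have "x = vs ! 0" "y = vs ! (n - 1)"
      using i by (auto simp: n_def rev_nth)
    then show ?thesis using \<open>0 < n\<close>
      by (auto simp: cyc_arcs_def n_def intro!: exI[of _ "n - 1"])
  qed
qed

lemma cyc_arcs_rev: "cyc_arcs (rev vs) = (cyc_arcs vs)\<inverse>"
  using cyc_arcs_rev_subset[of vs] cyc_arcs_rev_subset[of "rev vs"] by auto

text \<open>Each vertex of the list already has an outgoing pair in \<open>cyc_arcs vs\<close>, and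
  only one arc leaves a vertex, so no arc can be missing.\<close>

lemma cyc_arcs_eq_arcs:
  assumes "cyc_arcs vs \<subseteq> arcs (set vs)" shows "cyc_arcs vs = arcs (set vs)"
proof
  show "arcs (set vs) \<subseteq> cyc_arcs vs"
  proof clarify
    fix p q assume pq: "(p, q) \<in> arcs (set vs)"
    then obtain i where "i < length vs" "p = vs ! i"
      using arcsD(1) in_set_conv_nth by metis
    then have a: "(p, vs ! ((i + 1) mod length vs)) \<in> cyc_arcs vs"
      by (auto simp: cyc_arcs_def)
    then show "(p, q) \<in> cyc_arcs vs"
      using arcs_succ_unique[OF pq, of "vs ! ((i + 1) mod length vs)"] assms by auto
  qed
qed (rule assms)

lemma cyc_arcs_sorted:
  assumes "finite W" "2 \<le> card W"
  shows "cyc_arcs (sorted_list_of_set W) = arcs W"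
proof -
  define vs where "vs = sorted_list_of_set W"
  define n where "n = length vs"
  have set: "set vs = W" using assms by (simp add: vs_def)
  have n: "2 \<le> n" using assms by (simp add: n_def vs_def)
  have lt: "vs ! i < vs ! j \<longleftrightarrow> i < j" if "i < n" "j < n" for i j
  proof -
    have s: "sorted_wrt (<) vs" by (simp add: vs_def)
    show ?thesis
      using sorted_wrt_nth_less[OF s, of i j] sorted_wrt_nth_less[OF s, of j i] that
      by (cases i j rule: linorder_cases) (auto simp: n_def)
  qed
  have "(vs ! i, vs ! ((i + 1) mod n)) \<in> arcs W" if i: "i < n" for i
  proof (rule arcsI)
    define j where "j = (i + 1) mod n"
    have j: "j < n" "i + 1 < n \<and> j = i + 1 \<or> i = n - 1 \<and> j = 0"
      using i n by (auto simp: j_def mod_Suc)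
    show "vs ! i \<in> W" "vs ! ((i + 1) mod n) \<in> W"
      using i j nth_mem[of _ vs] by (auto simp: set j_def n_def)
    show "vs ! i \<noteq> vs ! ((i + 1) mod n)"
      using lt[of i j] lt[of j i] i j n by (auto simp flip: j_def)
    fix w assume "w \<in> W"
    then obtain k where k: "k < n" "w = vs ! k" using set in_set_conv_nth[of w vs] by (auto simp: n_def)
    show "\<not> cyc (vs ! i) w (vs ! ((i + 1) mod n))"
      using i j k lt[of i k] lt[of k j] lt[of j i] by (auto simp: cyc_def simp flip: j_def)
  qed
  then have "cyc_arcs vs \<subseteq> arcs (set vs)" by (auto simp: cyc_arcs_def n_def set)
  from cyc_arcs_eq_arcs[OF this] show ?thesis by (simp add: set) (simp add: vs_def)
qed

context outerplanar begin

text \<open>A path joining the two sides of an edge would have to cross it, so the edges of a cycle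
  join cyclically consecutive vertices.\<close>
lemma cycle_edge_consecutive:
  assumes Es: "\<And>u v. {u, v} \<in> Es \<longleftrightarrow> (u, v) \<in> E" and vs: "is_cycle Es vs" and i: "i < length vs"
  shows "(vs ! i, vs ! ((i + 1) mod length vs)) \<in> arcs (set vs) \<or>
    (vs ! ((i + 1) mod length vs), vs ! i) \<in> arcs (set vs)"
proof (rule ccontr)
  assume contr: "\<not> ?thesis"
  define n where "n = length vs"
  \<comment> \<open>Removing the edge from \<open>p\<close> to \<open>q\<close> leaves a path; the
    rotation lists it from \<open>q\<close> to \<open>p\<close>, so that its inner vertices have
    indices \<open>1\<close> to \<open>n - 2\<close>.\<close>
  define ws where "ws = rotate (i + 1) vs"
  define p where "p = vs ! i"
  define q where "q = vs ! ((i + 1) mod n)"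
  have n: "3 \<le> n" and dist: "distinct ws" and len: "length ws = n" and set: "set ws = set vs"
    using vs by (auto simp: is_cycle_def ws_def n_def)
  have edge: "(vs ! j, vs ! ((j + 1) mod n)) \<in> E" if "j < n" for j
    using vs that Es by (auto simp: is_cycle_def n_def)
  have wsn: "ws ! j = vs ! ((i + 1 + j) mod n)" if "j < n" for j
    unfolding ws_def n_def using that nth_rotate[of j vs "i + 1"] by (simp add: n_def ac_simps)
  have wse: "(ws ! j, ws ! (j + 1)) \<in> E" if "j + 1 < n" for j
    using wsn[of j] wsn[of "j + 1"] edge[of "(i + 1 + j) mod n"] that
    by (simp add: mod_Suc_eq)
  have q0: "ws ! 0 = q" and pn: "ws ! (n - 1) = p"
  proof -
    show "ws ! 0 = q" using wsn[of 0] n by (simp add: q_def)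
    have "i + 1 + (n - 1) = i + n" using n by simp
    then show "ws ! (n - 1) = p" using wsn[of "n - 1"] n i by (simp add: p_def n_def)
  qed
  have pq: "p \<in> set vs" "q \<in> set vs" "p \<noteq> q" "(p, q) \<in> E"
  proof -
    have "(i + 1) mod n < n" using n by simp
    then show "p \<in> set vs" "q \<in> set vs" using i by (simp_all add: p_def q_def n_def)
    show "(p, q) \<in> E" using edge[of i] i by (simp add: p_def q_def n_def)
    then show "p \<noteq> q" by (rule E_irrefl)
  qed
  obtain x y where xy: "x \<in> set vs" "cyc p x q" "y \<in> set vs" "cyc q y p"
  proof -
    have "(p, q) \<notin> arcs (set vs)" "(q, p) \<notin> arcs (set vs)"
      using contr by (simp_all add: p_def q_def n_def)
    then show ?thesis using pq that by (auto simp: arcs_def)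
  qed
  have inner: "cyc p (ws ! j) q \<longleftrightarrow> \<not> cyc q (ws ! j) p" if "0 < j" "j + 1 < n" for j
  proof -
    have "ws ! j \<noteq> q" "ws ! j \<noteq> p"
      using that nth_eq_iff_index_eq[OF dist, of j 0] nth_eq_iff_index_eq[OF dist, of j "n - 1"]
        len q0 pn by auto
    then show ?thesis using not_cyc_iff[OF pq(3), of "ws ! j"] by blast
  qed
  have step: "cyc p (ws ! j) q \<longleftrightarrow> cyc p (ws ! (j + 1)) q" if "0 < j" "j + 2 < n" for j
    using inner[of j] inner[of "j + 1"] that wse[of j] E_sym[OF wse[of j]] E_nocross[OF pq(4)]
    by auto
  have const: "cyc p (ws ! (j + 1)) q \<longleftrightarrow> cyc p (ws ! 1) q" if "j + 2 < n" for j
    using that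
  proof (induction j)
    case (Suc j) then show ?case using step[of "j + 1"] by simp
  qed simp
  have idx: "\<exists>j. j + 2 < n \<and> z = ws ! (j + 1)" if z: "z \<in> set vs" "z \<noteq> p" "z \<noteq> q" for z
  proof -
    obtain k where k: "k < n" "z = ws ! k" using z set len in_set_conv_nth[of z ws] by auto
    then have "k \<noteq> 0" "k \<noteq> n - 1" using z(2,3) q0 pn by metis+
    then show ?thesis using k by (intro exI[of _ "k - 1"]) auto
  qed
  obtain j where j: "j + 2 < n" "x = ws ! (j + 1)" using idx[OF xy(1)] cyc_distinct[OF xy(2)] by auto
  obtain k where k: "k + 2 < n" "y = ws ! (k + 1)" using idx[OF xy(3)] cyc_distinct[OF xy(4)] by auto
  show False
    using const[OF j(1)] const[OF k(1)] inner[of "j + 1"] inner[of "k + 1"] xy j k by auto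
qed

text \<open>The direction of the first edge propagates: if two consecutive edges followed the cyclic
  order in opposite senses, their common vertex would have two successors or two predecessors,
  making the vertices two steps apart equal.\<close>

lemma cycle_arcs:
  assumes Es: "\<And>u v. {u, v} \<in> Es \<longleftrightarrow> (u, v) \<in> E" and vs: "is_cycle Es vs"
  shows "polygon (set vs) \<and> (cyc_arcs vs = arcs (set vs) \<or> cyc_arcs vs = (arcs (set vs))\<inverse>)"
proof -
  define n where "n = length vs"
  define s where "s i = (i + 1) mod n" for i
  have n: "3 \<le> n" and dist: "distinct vs" using vs by (auto simp: is_cycle_def n_def)
  have cons: "(vs ! i, vs ! s i) \<in> arcs (set vs) \<or> (vs ! s i, vs ! i) \<in> arcs (set vs)"
    if "i < n" for i
    using cycle_edge_consecutive[OF Es vs] that by (simp add: n_def s_def)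
  have arcE: "cyc_arcs vs \<subseteq> E"
    using vs Es by (auto simp: is_cycle_def cyc_arcs_def)
  have s_Suc: "s i = i + 1" if "i + 1 < n" for i using that by (simp add: s_def)
  have ne: "vs ! i \<noteq> vs ! s (i + 1)" if "i + 1 < n" for i
  proof -
    have "s (i + 1) < n" "s (i + 1) \<noteq> i" using that n by (auto simp: s_def mod_Suc)
    then show ?thesis
      using nth_eq_iff_index_eq[OF dist, of i "s (i + 1)"] that by (simp add: n_def)
  qed
  have arcs: "cyc_arcs vs = arcs (set vs) \<or> cyc_arcs vs = (arcs (set vs))\<inverse>"
  proof (cases "(vs ! 0, vs ! s 0) \<in> arcs (set vs)")
    case True
    have "(vs ! i, vs ! s i) \<in> arcs (set vs)" if "i < n" for i
      using that
    proof (induction i)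
      case (Suc i)
      then show ?case
        using cons[of "i + 1"] arcs_pred_unique[of "vs ! i" "vs ! (i + 1)" "set vs" "vs ! s (i + 1)"]
          s_Suc[of i] ne[of i] by auto
    qed (rule True)
    then have "cyc_arcs vs \<subseteq> arcs (set vs)" by (auto simp: cyc_arcs_def n_def s_def)
    then show ?thesis using cyc_arcs_eq_arcs by blast
  next
    case False
    then have 0: "(vs ! s 0, vs ! 0) \<in> arcs (set vs)" using cons[of 0] n by auto
    have "(vs ! s i, vs ! i) \<in> arcs (set vs)" if "i < n" for i
      using that
    proof (induction i)
      case (Suc i)
      then show ?case
        using cons[of "i + 1"] arcs_succ_unique[of "vs ! (i + 1)" "vs ! i" "set vs" "vs ! s (i + 1)"]
          s_Suc[of i] ne[of i] by auto
    qed (rule 0)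
    then have "(cyc_arcs vs)\<inverse> \<subseteq> arcs (set vs)" by (auto simp: cyc_arcs_def n_def s_def)
    then have "cyc_arcs (rev vs) = arcs (set (rev vs))"
      by (intro cyc_arcs_eq_arcs) (simp add: cyc_arcs_rev)
    then show ?thesis by (auto simp: cyc_arcs_rev)
  qed
  have "arcs (set vs) \<subseteq> E" using arcs arcE E_sym unfolding converse_unfold by blast
  moreover have "set vs \<subseteq> V"
  proof
    fix v assume "v \<in> set vs"
    then obtain i where "i < n" "v = vs ! i" by (auto simp: in_set_conv_nth n_def)
    then show "v \<in> V" using arcE E_V[of v] by (force simp: cyc_arcs_def n_def)
  qed
  moreover have "3 \<le> card (set vs)" using n dist by (simp add: distinct_card n_def)
  ultimately show ?thesis using arcs by (auto simp: polygon_def)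
qed

lemma polygon_cycle:
  assumes Es: "\<And>u v. {u, v} \<in> Es \<longleftrightarrow> (u, v) \<in> E" and W: "polygon W"
  obtains vs where "is_cycle Es vs" "cyc_arcs vs = arcs W"
proof -
  define vs where "vs = sorted_list_of_set W"
  have eq: "cyc_arcs vs = arcs W"
    using cyc_arcs_sorted[OF polygon_finite[OF W]] W by (simp add: vs_def polygon_def)
  moreover have "is_cycle Es vs"
    using W eq polygon_finite[OF W] Es
    by (auto simp: is_cycle_def polygon_def vs_def cyc_arcs_def)
  ultimately show ?thesis using that by blast
qed

text \<open>\<open>G_separated\<close> mentions one direction of each cycle only; the second clause
  of \<open>separated\<close> is recovered by traversing the cycle backwards.\<close>

lemma G_separated_iff:
  assumes Es: "\<And>u v. {u, v} \<in> Es \<longleftrightarrow> (u, v) \<in> E"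
  shows "G_separated Es X Y \<longleftrightarrow> separated X Y"
proof
  assume g: "G_separated Es X Y"
  show "separated X Y"
    unfolding separated_def
  proof (intro allI impI)
    fix W assume "polygon W"
    from polygon_cycle[OF Es this] obtain vs where vs: "is_cycle Es vs" "cyc_arcs vs = arcs W" .
    have r: "is_cycle Es (rev vs)"
      unfolding is_cycle_def
    proof (intro conjI allI impI)
      fix i assume "i < length (rev vs)"
      then have "(rev vs ! i, rev vs ! ((i + 1) mod length (rev vs))) \<in> cyc_arcs (rev vs)"
        by (auto simp: cyc_arcs_def)
      then show "{rev vs ! i, rev vs ! ((i + 1) mod length (rev vs))} \<in> Es"
        using \<open>polygon W\<close> vs(2) E_sym Es by (auto simp: cyc_arcs_rev polygon_def)
    qed (use vs in \<open>auto simp: is_cycle_def\<close>)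
    show "\<not> (arcs W \<subseteq> X \<and> (arcs W)\<inverse> \<subseteq> Y) \<and> \<not> ((arcs W)\<inverse> \<subseteq> X \<and> arcs W \<subseteq> Y)"
      using g vs r unfolding G_separated_def directed_along_iff by (metis cyc_arcs_rev rev_rev_ident)
  qed
next
  assume s: "separated X Y"
  have False if "is_cycle Es vs" "cyc_arcs vs \<subseteq> X" "(cyc_arcs vs)\<inverse> \<subseteq> Y" for vs
    using cycle_arcs[OF Es that(1)] s that(2,3) unfolding separated_def by auto
  then show "G_separated Es X Y"
    unfolding G_separated_def directed_along_iff cyc_arcs_rev by blast
qed

lemma total_orientation_iff:
  assumes Es: "\<And>u v. {u, v} \<in> Es \<longleftrightarrow> (u, v) \<in> E"
  shows "total_orientation Es X \<longleftrightarrow> total X"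
  unfolding total_orientation_def total_def Es by auto

lemma maximal_separated_collection_iff:
  assumes Es: "\<And>u v. {u, v} \<in> Es \<longleftrightarrow> (u, v) \<in> E"
  shows "maximal_separated_collection Es S \<longleftrightarrow>
    collection S \<and> (\<forall>S'. collection S' \<and> S \<subseteq> S' \<longrightarrow> S' = S)"
  unfolding maximal_separated_collection_def separated_collection_def collection_def
    G_separated_iff[OF Es] total_orientation_iff[OF Es] ..

lemma card_maximal_collections:
  assumes Es: "\<And>u v. {u, v} \<in> Es \<longleftrightarrow> (u, v) \<in> E"
  shows "card {S. maximal_separated_collection Es S} = card {P. biclosed P}"
  using bij_betw_same_card[OF maximal_collections_bij]
  by (simp add: maximal_separated_collection_iff[OF Es])

end

section \<open>Biclosed families and connected sets\<close>

text \<open>Biclosed families for an abstract splitting relation: \<open>R x y z\<close> means that \<open>z\<close> splits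
  into \<open>x\<close> and \<open>y\<close>.\<close>
definition bic :: "'a set \<Rightarrow> ('a \<Rightarrow> 'a \<Rightarrow> 'a \<Rightarrow> bool) \<Rightarrow> 'a set \<Rightarrow> bool" where
  "bic K R P \<longleftrightarrow> P \<subseteq> K \<and> (\<forall>x\<in>K. \<forall>y\<in>K. \<forall>z\<in>K. R x y z \<longrightarrow>
     (x \<in> P \<and> y \<in> P \<longrightarrow> z \<in> P) \<and> (z \<in> P \<longrightarrow> x \<in> P \<or> y \<in> P))"

lemma card_bic_transfer:
  assumes bij: "bij_betw h K K'"
    and R: "\<And>x y z. x \<in> K \<Longrightarrow> y \<in> K \<Longrightarrow> z \<in> K \<Longrightarrow> R x y z \<longleftrightarrow> R' (h x) (h y) (h z)"
  shows "card {P. bic K R P} = card {P. bic K' R' P}"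
proof (rule bij_betw_same_card)
  have mem: "h x \<in> h ` P \<longleftrightarrow> x \<in> P" if "x \<in> K" "P \<subseteq> K" for x P
    using bij that by (meson bij_betw_def inj_on_image_mem_iff)
  have K': "K' = h ` K" using bij by (simp add: bij_betw_def)
  have iff: "bic K' R' (h ` P) \<longleftrightarrow> bic K R P" if "P \<subseteq> K" for P
    using that by (simp add: bic_def K' image_mono mem R cong: ball_cong)
  show "bij_betw ((`) h) {P. bic K R P} {P. bic K' R' P}"
  proof (rule bij_betw_imageI)
    show "inj_on ((`) h) {P. bic K R P}"
      using inj_on_image_Pow[of h K] bij unfolding bij_betw_def bic_def
      by (rule_tac inj_on_subset) auto
    show "(`) h ` {P. bic K R P} = {P. bic K' R' P}"
    proof (intro subset_antisym subsetI)
      fix Q assume "Q \<in> (`) h ` {P. bic K R P}"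
      then obtain P where P: "bic K R P" "Q = h ` P" by blast
      moreover from this have "P \<subseteq> K" by (simp add: bic_def)
      ultimately show "Q \<in> {P. bic K' R' P}" using iff by simp
    next
      fix Q assume Q: "Q \<in> {P. bic K' R' P}"
      then have "Q \<subseteq> h ` K" by (simp add: bic_def K')
      then obtain P where "P \<subseteq> K" "Q = h ` P" by (meson subset_image_iff)
      then show "Q \<in> (`) h ` {P. bic K R P}" using iff Q by auto
    qed
  qed
qed

text \<open>Growth by one vertex at a time gives the induction by which triangles are attached and
  subtrees are enumerated; the empty set is excluded.\<close>

inductive conn :: "('a \<Rightarrow> 'a \<Rightarrow> bool) \<Rightarrow> 'a set \<Rightarrow> 'a set \<Rightarrow> bool" for adj T where
  single: "x \<in> T \<Longrightarrow> conn adj T {x}"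
| insert: "conn adj T X \<Longrightarrow> x \<in> X \<Longrightarrow> y \<in> T \<Longrightarrow> adj x y \<Longrightarrow> conn adj T (insert y X)"

text \<open>For subtrees of a tree this amounts to deleting one edge, which in the dual tree means
  cutting along a diagonal.\<close>

definition dsplit :: "'a set \<Rightarrow> 'a set \<Rightarrow> 'a set \<Rightarrow> bool" where
  "dsplit X Y Z \<longleftrightarrow> X \<inter> Y = {} \<and> Z = X \<union> Y"

lemma conn_subset: "conn adj T X \<Longrightarrow> X \<subseteq> T"
  by (induction rule: conn.induct) auto

lemma conn_nonempty: "conn adj T X \<Longrightarrow> X \<noteq> {}"
  by (induction rule: conn.induct) auto

text \<open>Induction on \<open>Y\<close>. If the point of contact is the vertex \<open>z\<close>
  added last, \<open>z\<close> is first moved over to \<open>X\<close>, and contact with the rest of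
  \<open>Y\<close> is then made by \<open>z\<close> itself.\<close>

lemma conn_Un:
  assumes sym: "\<And>x y. x \<in> T \<Longrightarrow> y \<in> T \<Longrightarrow> adj x y \<Longrightarrow> adj y x"
  shows "conn adj T Y \<Longrightarrow> conn adj T X \<Longrightarrow> x \<in> X \<Longrightarrow> y \<in> Y \<Longrightarrow> adj x y \<Longrightarrow> conn adj T (X \<union> Y)"
proof (induction arbitrary: X x y rule: conn.induct)
  case (single z)
  then show ?case using conn.insert[of adj T X x z] by auto
next
  case (insert Y w z)
  show ?case
  proof (cases "y \<in> Y")
    case True
    then have "conn adj T (X \<union> Y)" using insert by blast
    then show ?thesis using conn.insert[of adj T "X \<union> Y" w z] insert by auto
  next
    case False
    then have "y = z" using insert by auto
    then have "conn adj T (insert z X)" using conn.insert insert by metis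
    then have "conn adj T (insert z X \<union> Y)"
      using insert.IH[of "insert z X" z w] insert.hyps sym conn_subset[OF insert.hyps(1)] by blast
    then show ?thesis by simp
  qed
qed

lemma conn_image:
  assumes adj: "\<And>x y. x \<in> T \<Longrightarrow> y \<in> T \<Longrightarrow> adj x y \<Longrightarrow> adj' (f x) (f y)" and f: "f ` T \<subseteq> T'"
  shows "conn adj T X \<Longrightarrow> conn adj' T' (f ` X)"
proof (induction rule: conn.induct)
  case (single x) then show ?case using f by (auto intro: conn.single)
next
  case (insert X x y)
  then have "x \<in> T" using conn_subset by blast
  then show ?case using conn.insert[OF insert.IH, of "f x" "f y"] insert f adj by auto
qed

lemma bij_betw_conn:
  assumes f: "bij_betw f T T'" and adj: "\<And>x y. x \<in> T \<Longrightarrow> y \<in> T \<Longrightarrow> adj x y \<longleftrightarrow> adj' (f x) (f y)"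
  shows "bij_betw ((`) f) {X. conn adj T X} {X. conn adj' T' X}"
proof (rule bij_betw_imageI)
  have inj: "inj_on f T" and im: "f ` T = T'" using f by (auto simp: bij_betw_def)
  show "inj_on ((`) f) {X. conn adj T X}"
    by (rule inj_on_subset[OF inj_on_image_Pow[OF inj]]) (use conn_subset in blast)
  show "(`) f ` {X. conn adj T X} = {X. conn adj' T' X}"
  proof (intro subset_antisym subsetI)
    fix Y assume "Y \<in> (`) f ` {X. conn adj T X}"
    then show "Y \<in> {X. conn adj' T' X}"
      using conn_image[of T adj adj' f T'] adj im by auto
  next
    fix Y assume Y: "Y \<in> {X. conn adj' T' X}"
    define g where "g = the_inv_into T f"
    have g: "g y \<in> T" "f (g y) = y" if "y \<in> T'" for y
      using that f_the_inv_into_f[OF inj] the_inv_into_into[OF inj] im by (auto simp: g_def)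
    have "conn adj T (g ` Y)"
      using conn_image[of T' adj' adj g T Y] Y g adj by auto
    moreover have "f ` g ` Y = Y" using g conn_subset[of adj' T' Y] Y by force
    ultimately show "Y \<in> (`) f ` {X. conn adj T X}" by (metis image_eqI mem_Collect_eq)
  qed
qed

lemma card_bic_conn_iso:
  assumes f: "bij_betw f T T'" and adj: "\<And>x y. x \<in> T \<Longrightarrow> y \<in> T \<Longrightarrow> adj x y \<longleftrightarrow> adj' (f x) (f y)"
  shows "card {P. bic {X. conn adj T X} dsplit P} = card {P. bic {X. conn adj' T' X} dsplit P}"
proof (rule card_bic_transfer)
  show "bij_betw ((`) f) {X. conn adj T X} {X. conn adj' T' X}"
    using bij_betw_conn[where adj = adj and adj' = adj', OF f] adj by blast
  have inj: "inj_on f T" using f by (simp add: bij_betw_def)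
  fix X Y Z assume "X \<in> {X. conn adj T X}" "Y \<in> {X. conn adj T X}" "Z \<in> {X. conn adj T X}"
  then have "X \<subseteq> T" "Y \<subseteq> T" "Z \<subseteq> T" using conn_subset by blast+
  then show "dsplit X Y Z \<longleftrightarrow> dsplit (f ` X) (f ` Y) (f ` Z)"
    unfolding dsplit_def
    using inj_on_image_Int[OF inj, of X Y] inj_on_image_eq_iff[OF inj, of Z "X \<union> Y"]
    by (auto simp: image_Un)
qed

section \<open>Polygons of a triangulation and subtrees of the dual tree\<close>

context outerplanar begin

section \<open>Polygons with the maximal number of chords\<close>

definition chords :: "nat set \<Rightarrow> (nat \<times> nat) set" where
  "chords W = {(p, q). p < q \<and> chord W p q}"

text \<open>A \<open>k\<close>-gon has at most \<open>k - 3\<close> non-crossing chords, and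
  equality is inherited by the pieces. In this way the cardinality in
  \<open>is_triangulation\<close> yields a chord in every polygon that is not a triangle.\<close>

definition tight :: "nat set \<Rightarrow> bool" where
  "tight W \<longleftrightarrow> card (chords W) + 3 = card W"

lemma finite_chords: "finite W \<Longrightarrow> finite (chords W)"
  by (rule finite_subset[of _ "W \<times> W"]) (auto simp: chords_def chord_def)

lemma chord_of_half:
  assumes "chord (half W p q) r s" "p \<in> W" "q \<in> W" shows "chord W r s"
  using assms arcs_subset[of r s W "half W p q"] arcs_subset[of s r W "half W p q"]
    half_subset[of W p q] by (auto simp: chord_def)

lemma chords_split:
  assumes pq: "chord W p q" "p < q"
  shows "chords W = insert (p, q) (chords (half W p q) \<union> chords (half W q p))"
    "chords (half W p q) \<inter> chords (half W q p) = {}"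
    "(p, q) \<notin> chords (half W p q) \<union> chords (half W q p)"
proof -
  have W: "p \<in> W" "q \<in> W" "p \<noteq> q" using pq by (auto simp: chord_def)
  note a = half_arc[OF W] half_arc[OF W(2,1) W(3)[symmetric]]
  show n: "(p, q) \<notin> chords (half W p q) \<union> chords (half W q p)"
    using a by (auto simp: chords_def chord_def)
  show "chords (half W p q) \<inter> chords (half W q p) = {}"
  proof (rule ccontr)
    assume "\<not> ?thesis"
    then obtain r s where rs: "r < s" "chord (half W p q) r s" "chord (half W q p) r s"
      by (auto simp: chords_def)
    then have "r \<in> {p, q}" "s \<in> {p, q}"
      using half_Int[OF W(3,1,2)] by (auto simp: chord_def)
    then show False using rs a pq(2) by (auto simp: chord_def)
  qed
  show "chords W = insert (p, q) (chords (half W p q) \<union> chords (half W q p))"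
  proof (intro subset_antisym subsetI)
    fix x assume "x \<in> chords W"
    then obtain r s where rs: "x = (r, s)" "r < s" "chord W r s" by (auto simp: chords_def)
    show "x \<in> insert (p, q) (chords (half W p q) \<union> chords (half W q p))"
      using chord_same_side[OF pq(1) rs(3)] chord_in_half[OF rs(3), of p q]
        chord_in_half[OF rs(3), of q p] W rs(1,2) pq(2) by (auto simp: chords_def)
  next
    fix x assume "x \<in> insert (p, q) (chords (half W p q) \<union> chords (half W q p))"
    then show "x \<in> chords W"
      using pq chord_of_half[of W p q] chord_of_half[of W q p] W by (auto simp: chords_def)
  qed
qed

lemma card_chords_split:
  assumes "finite W" "chord W p q" "p < q"
  shows "card (chords W) = card (chords (half W p q)) + card (chords (half W q p)) + 1"
  using chords_split[OF assms(2,3)] finite_chords finite_subset[OF half_subset assms(1)]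
  by (simp add: card_Un_disjoint)

text \<open>The halves share two vertices and the cut uses up one chord: from
  \<open>c1 + 3 <= h1\<close>, \<open>c2 + 3 <= h2\<close> and \<open>h1 + h2 = card W + 2\<close>
  the bound follows for \<open>c1 + c2 + 1\<close> chords.\<close>

lemma card_chords_le:
  "finite W \<Longrightarrow> 3 \<le> card W \<Longrightarrow> card (chords W) + 3 \<le> card W"
proof (induction "card W" arbitrary: W rule: less_induct)
  case less
  show ?case
  proof (cases "chords W = {}")
    case False
    then obtain p q where pq: "chord W p q" "p < q" by (auto simp: chords_def)
    note qp = chord_sym[OF pq(1)]
    have lt: "card (half W p q) < card W" "card (half W q p) < card W"
      using psubset_card_mono[OF less.prems(1)] chord_half_psubset[OF pq(1)] chord_half_psubset[OF qp]
      by simp_all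
    have f: "finite (half W p q)" "finite (half W q p)"
      using finite_subset[OF half_subset less.prems(1)] by blast+
    show ?thesis
      using less.hyps[OF lt(1) f(1)] less.hyps[OF lt(2) f(2)] chord_half_card[OF less.prems(1)] pq(1) qp
        card_chords_split[OF less.prems(1) pq] card_half[OF less.prems(1), of p q] pq
      by (auto simp: chord_def)
  qed (use less in simp)
qed

lemma tight_half:
  assumes fin: "finite W" and t: "tight W" and ch: "chord W p q"
  shows "tight (half W p q)"
proof -
  have *: "tight (half W p q) \<and> tight (half W q p)" if "chord W p q" "p < q" for p q
  proof -
    have f: "finite (half W p q)" "finite (half W q p)"
      using finite_subset[OF half_subset fin] by blast+
    show ?thesis
      using card_chords_le[OF f(1) chord_half_card[OF fin that(1)]]
        card_chords_le[OF f(2) chord_half_card[OF fin chord_sym[OF that(1)]]]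
        card_chords_split[OF fin that] card_half[OF fin, of p q] that t
      by (auto simp: chord_def tight_def)
  qed
  show ?thesis using *[of p q] *[of q p] ch chord_sym[OF ch] chord_neq[OF ch] by (meson linorder_neqE_nat)
qed

text \<open>An arc of \<open>W\<close> that is a chord of \<open>Z\<close> cuts off a piece of
  \<open>Z\<close> without losing any vertex of \<open>W\<close>, so repeated halving leads down
  from \<open>Z\<close> to \<open>W\<close>.\<close>

lemma tight_polygon:
  "tight Z \<Longrightarrow> polygon Z \<Longrightarrow> polygon W \<Longrightarrow> W \<subseteq> Z \<Longrightarrow> tight W"
proof (induction "card Z" arbitrary: Z rule: less_induct)
  case less
  note fin = polygon_finite[OF less.prems(2)]
  show ?case
  proof (cases "W = Z")
    case False
    then obtain p q where pq: "(p, q) \<in> arcs W" "(p, q) \<notin> arcs Z"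
      using arcs_new[OF fin, of W] less.prems by (auto simp: polygon_def)
    have ch: "chord Z p q" using polygon_arc_notin_chord[OF less.prems(3,4) pq] .
    show ?thesis
      using less.hyps[of "half Z p q"] tight_half[OF fin less.prems(1) ch]
        chord_half_polygon[OF less.prems(2) ch] arc_subset_half[OF pq(1) less.prems(4)]
        psubset_card_mono[OF fin chord_half_psubset[OF ch]] less.prems(3) by blast
  qed (use less in simp)
qed

lemma tight_chord_ex:
  assumes "tight W" "card W \<noteq> 3" obtains p q where "chord W p q"
proof -
  have "chords W \<noteq> {}" using assms by (auto simp: tight_def)
  then show ?thesis using that by (auto simp: chords_def)
qed

end

section \<open>Polygons as connected sets of triangles\<close>

locale triangulated = outerplanar +
  assumes chord_ex: "polygon W \<Longrightarrow> card W \<noteq> 3 \<Longrightarrow> \<exists>p q. chord W p q"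
begin

definition tris :: "nat set set" where
  "tris = {t. polygon t \<and> card t = 3}"

definition inner :: "nat set \<Rightarrow> nat set set" where
  "inner W = {t \<in> tris. t \<subseteq> W}"

definition adj :: "nat set \<Rightarrow> nat set \<Rightarrow> bool" where
  "adj s t \<longleftrightarrow> s \<noteq> t \<and> (\<exists>p q. p \<noteq> q \<and> p \<in> s \<inter> t \<and> q \<in> s \<inter> t)"

lemma tris_arc:
  assumes "t \<in> tris" "(p, q) \<in> arcs t"
  obtains k where "t = {p, q, k}" "cyc q k p" "(q, k) \<in> E" "(k, p) \<in> E"
proof -
  have t: "card t = 3" "arcs t \<subseteq> E" using assms by (auto simp: tris_def polygon_def)
  note pq = arcsD[OF assms(2)]
  obtain k where k: "k \<in> t" "k \<noteq> p" "k \<noteq> q" using card3_other[of t] t by auto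
  have "card {p, q, k} = 3" using pq(3) k by auto
  moreover have "finite t" using t(1) by (metis card.infinite zero_neq_numeral)
  ultimately have eq: "t = {p, q, k}"
    using card_subset_eq[of t "{p, q, k}"] k pq t by auto
  have c: "cyc q k p" using pq(4)[OF k(1)] k not_cyc_iff[OF pq(3), of k] by auto
  have "(q, k) \<in> arcs t" "(k, p) \<in> arcs t"
    using c pq(3) k by (auto simp: eq arcs_def cyc_def)
  then show ?thesis using that eq c t by blast
qed

lemma tris_edge:
  assumes "t \<in> tris" "x \<in> t" "y \<in> t" "x \<noteq> y" shows "(x, y) \<in> E" "(x, y) \<in> arcs t \<or> (y, x) \<in> arcs t"
proof -
  have t: "finite t" "arcs t \<subseteq> E" using assms polygon_finite by (auto simp: tris_def polygon_def)
  obtain q where q: "(x, q) \<in> arcs t" using arcs_succ_ex[OF t(1) assms(2-4)] .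
  obtain k where k: "t = {x, q, k}" "cyc q k x" "(k, x) \<in> E" using tris_arc[OF assms(1) q] .
  have "y = q \<or> y = k" using k assms by auto
  moreover have "(k, x) \<in> arcs t" using k q by (auto simp: arcs_def cyc_def)
  ultimately show "(x, y) \<in> arcs t \<or> (y, x) \<in> arcs t" using q by auto
  then show "(x, y) \<in> E" using t(2) E_sym by blast
qed

text \<open>Two different apexes behind the same arc would produce crossing edges.\<close>

lemma tris_unique:
  assumes "s \<in> tris" "t \<in> tris" "(p, q) \<in> arcs s" "(p, q) \<in> arcs t" shows "s = t"
proof -
  obtain k where k: "s = {p, q, k}" "cyc q k p" "(q, k) \<in> E" "(k, p) \<in> E" using tris_arc[OF assms(1,3)] .
  obtain l where l: "t = {p, q, l}" "cyc q l p" "(q, l) \<in> E" "(l, p) \<in> E" using tris_arc[OF assms(2,4)] .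
  have "k = l"
  proof (rule ccontr)
    assume "k \<noteq> l"
    then have "cyc q k l \<and> cyc l p q \<or> cyc q l k \<and> cyc k p q"
      using k(2) l(2) by (auto simp: cyc_def)
    then show False
      using E_nocross[OF l(3) k(4)] E_nocross[OF k(3) l(4)] by auto
  qed
  then show ?thesis using k l by simp
qed

lemma inner_mono: "W \<subseteq> W' \<Longrightarrow> inner W \<subseteq> inner W'"
  by (auto simp: inner_def)

lemma inner_tri: "t \<in> tris \<Longrightarrow> inner t = {t}"
proof -
  assume t: "t \<in> tris"
  have "s = t" if "s \<in> tris" "s \<subseteq> t" for s
    using card_subset_eq[of t s] that t polygon_finite by (auto simp: tris_def)
  then show "inner t = {t}" using t by (auto simp: inner_def)
qed

text \<open>A triangle on neither side would have an edge crossing the chord, and one on both sides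
  would have only two vertices.\<close>

lemma inner_split:
  assumes "chord W p q"
  shows "inner W = inner (half W p q) \<union> inner (half W q p)" "inner (half W p q) \<inter> inner (half W q p) = {}"
proof -
  have W: "p \<in> W" "q \<in> W" "(p, q) \<in> E" "p \<noteq> q" using assms chord_neq by (auto simp: chord_def)
  show "inner (half W p q) \<inter> inner (half W q p) = {}"
  proof (rule ccontr)
    assume "\<not> ?thesis"
    then obtain t where t: "t \<in> tris" "t \<subseteq> {p, q}"
      using half_Int[OF W(4,1,2)] by (auto simp: inner_def)
    then have "card t \<le> card {p, q}" by (intro card_mono) auto
    then show False using t(1) W by (auto simp: tris_def)
  qed
  have "t \<subseteq> half W p q \<or> t \<subseteq> half W q p" if t: "t \<in> tris" "t \<subseteq> W" for t
  proof (rule ccontr)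
    assume "\<not> ?thesis"
    then obtain x y where xy: "x \<in> t" "x \<notin> half W p q" "y \<in> t" "y \<notin> half W q p" by blast
    moreover from this have "x \<noteq> y" using half_Un[of p q W] W t by blast
    ultimately have "(x, y) \<in> E" using tris_edge t by blast
    then show False using same_side[OF W(3), of x y W] xy t by blast
  qed
  then show "inner W = inner (half W p q) \<union> inner (half W q p)"
    using half_subset[of W p q] half_subset[of W q p] by (auto simp: inner_def)
qed

lemma polygon_induct [consumes 1, case_names tri split]:
  assumes "polygon W"
    and tri: "\<And>t. t \<in> tris \<Longrightarrow> Q t"
    and split: "\<And>W p q. polygon W \<Longrightarrow> chord W p q \<Longrightarrow> Q (half W p q) \<Longrightarrow> Q (half W q p) \<Longrightarrow> Q W"
  shows "Q W"
  using assms(1)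
proof (induction "card W" arbitrary: W rule: less_induct)
  case less
  show ?case
  proof (cases "card W = 3")
    case True then show ?thesis using less.prems tri by (simp add: tris_def)
  next
    case False
    then obtain p q where ch: "chord W p q" using chord_ex less.prems by blast
    note c = ch chord_sym[OF ch]
    have "Q (half W p q)" "Q (half W q p)"
      using less.hyps chord_half_polygon[OF less.prems] c chord_half_psubset
        psubset_card_mono[OF polygon_finite[OF less.prems]] by simp_all
    then show ?thesis using split[OF less.prems ch] by simp
  qed
qed

lemma arc_inner:
  assumes "polygon W" "(p, q) \<in> arcs W"
  obtains t where "t \<in> inner W" "(p, q) \<in> arcs t"
proof -
  from assms have "\<exists>t\<in>inner W. (p, q) \<in> arcs t"
  proof (induction rule: polygon_induct)
    case (tri t)
    then show ?case using inner_tri by blast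
  next
    case (split W r s)
    have pq: "(p, q) \<in> E" "p \<in> W" "q \<in> W"
      using split arcsD[OF split.prems] by (auto simp: polygon_def)
    have rs: "(r, s) \<in> E" using split.hyps by (simp add: chord_def)
    show ?case
      using same_side[OF rs pq] split.IH arcs_subset[OF split.prems half_subset]
        inner_mono[OF half_subset] by blast
  qed
  then show ?thesis using that by blast
qed

text \<open>Each vertex starts an arc, and each arc belongs to an inner triangle. A polygon is
  thereby determined by its triangles.\<close>

lemma Union_inner:
  assumes "polygon W" shows "\<Union>(inner W) = W"
proof
  show "W \<subseteq> \<Union>(inner W)"
  proof
    fix w assume w: "w \<in> W"
    obtain y where "y \<in> W" "y \<noteq> w" using card3_other[of W] assms by (metis polygon_def)
    then obtain q where "(w, q) \<in> arcs W" using arcs_succ_ex[OF polygon_finite[OF assms] w] by metis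
    then obtain t where "t \<in> inner W" "(w, q) \<in> arcs t" using arc_inner[OF assms] by metis
    then show "w \<in> \<Union>(inner W)" using arcsD(1) by blast
  qed
qed (auto simp: inner_def)

lemma adj_sym: "adj s t \<Longrightarrow> adj t s"
  by (auto simp: adj_def)

text \<open>The triangles on the two sides of the chord, at \<open>(p, q)\<close> and at
  \<open>(q, p)\<close>, are adjacent and connect the two parts.\<close>

lemma conn_inner: "polygon W \<Longrightarrow> conn adj tris (inner W)"
proof (induction rule: polygon_induct)
  case (tri t)
  then show ?case by (simp add: inner_tri conn.single)
next
  case (split W p q)
  note ch = split.hyps(2) and qp = chord_sym[OF split.hyps(2)]
  have W: "p \<in> W" "q \<in> W" "p \<noteq> q" using ch chord_neq by (auto simp: chord_def)
  obtain s where s: "s \<in> inner (half W p q)" "(p, q) \<in> arcs s"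
    using arc_inner[OF chord_half_polygon[OF split.hyps(1) ch] half_arc[OF W]] .
  obtain t where t: "t \<in> inner (half W q p)" "(q, p) \<in> arcs t"
    using arc_inner[OF chord_half_polygon[OF split.hyps(1) qp] half_arc[OF W(2,1) W(3)[symmetric]]] .
  have "adj s t"
    using s t inner_split(2)[OF ch] W(3) arcsD(1,2)[OF s(2)] arcsD(1,2)[OF t(2)]
    unfolding adj_def by blast
  then show ?case
    using conn_Un[OF adj_sym split.IH(2,1) s(1) t(1)] inner_split(1)[OF ch] by simp
qed

lemma inner_inject: "polygon W \<Longrightarrow> polygon W' \<Longrightarrow> inner W = inner W' \<Longrightarrow> W = W'"
  by (metis Union_inner)

lemma arcs_halves:
  assumes "p \<in> W" "q \<in> W"
  shows "arcs W \<subseteq> arcs (half W p q) \<union> arcs (half W q p)"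
proof clarify
  fix u v assume a: "(u, v) \<in> arcs W" "(u, v) \<notin> arcs (half W q p)"
  note uv = arcsD[OF a(1)]
  have "p \<noteq> q" using a by (auto simp: half_def cyc_def)
  have "\<not> cyc p u q \<and> \<not> cyc p v q \<or> \<not> cyc q u p \<and> \<not> cyc q v p"
    using uv(3) uv(4)[OF assms(1)] uv(4)[OF assms(2)] \<open>p \<noteq> q\<close>
    unfolding cyc_def by (smt (verit, best) nat_neq_iff order_less_trans)
  then have "u \<in> half W p q \<and> v \<in> half W p q"
    using a uv(1,2) arcs_subset[OF a(1) half_subset, of q p] by (auto simp: half_def)
  then show "(u, v) \<in> arcs (half W p q)"
    using arcs_subset[OF a(1) half_subset] by blast
qed

text \<open>A new triangle \<open>t\<close> meets some triangle \<open>s\<close> of \<open>W\<close>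
  in a side. That side is an arc of \<open>W\<close>, since otherwise \<open>t\<close>, the only
  triangle behind it, would already be in \<open>W\<close>. So the apex of \<open>t\<close> lies
  outside \<open>W\<close>, and adding it to the vertex set glues \<open>t\<close> on.\<close>

lemma conn_imp_inner: "conn adj tris X \<Longrightarrow> \<exists>W. polygon W \<and> inner W = X"
proof (induction rule: conn.induct)
  case (single t)
  then show ?case using inner_tri by (auto simp: tris_def)
next
  case (insert X s t)
  then obtain W where W: "polygon W" "inner W = X" by blast
  show ?case
  proof (cases "t \<in> X")
    case True then show ?thesis using W by (auto simp: insert_absorb)
  next
    case False
    have s: "s \<in> tris" "s \<subseteq> W" using insert.hyps W by (auto simp: inner_def)
    note t = insert.hyps(3)
    obtain p q where pq: "(p, q) \<in> arcs s" "p \<in> t" "q \<in> t" "p \<noteq> q" "s \<noteq> t"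
      using insert.hyps(4) tris_edge(2)[OF s(1)] unfolding adj_def by blast
    have qp: "(q, p) \<in> arcs t"
      using tris_edge(2)[OF t pq(2-4)] tris_unique[OF s(1) t pq(1)] pq(5) by auto
    obtain k where k: "t = {q, p, k}" "cyc p k q" using tris_arc[OF t qp] .
    have pqW: "p \<in> W" "q \<in> W" using arcsD[OF pq(1)] s(2) by blast+
    have arc: "(p, q) \<in> arcs W"
    proof (rule ccontr)
      assume "(p, q) \<notin> arcs W"
      then have ch: "chord W p q"
        using polygon_arc_notin_chord[of s W p q] s pq by (auto simp: tris_def)
      note c = chord_sym[OF ch]
      obtain u where "u \<in> inner (half W q p)" "(q, p) \<in> arcs u"
        using arc_inner[OF chord_half_polygon[OF W(1) c] half_arc[OF pqW(2,1)]] pq(4) by auto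
      then have "t \<in> inner W"
        using tris_unique[OF _ t _ qp] inner_mono[OF half_subset, of W q p] by (auto simp: inner_def)
      then show False using False W by simp
    qed
    define W' where "W' = insert k W"
    have h1: "half W' p q = W"
      using k arcsD(4)[OF arc] by (auto simp: half_def W'_def)
    have h2: "half W' q p = t"
      using k pqW arcsD(4)[OF arc] not_cyc_iff[OF pq(4)] pq(4)
      by (auto simp: half_def W'_def cyc_distinct) (auto simp: cyc_def)
    have fin: "finite W'" using polygon_finite[OF W(1)] by (simp add: W'_def)
    have W': "polygon W'"
      unfolding polygon_def
    proof (intro conjI)
      show "W' \<subseteq> V" using W t k by (auto simp: W'_def polygon_def tris_def)
      show "3 \<le> card W'" using W card_mono[OF fin, of W] by (simp add: W'_def polygon_def subset_insertI)
      show "arcs W' \<subseteq> E"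
        using arcs_halves[of p W' q] h1 h2 pqW W t by (auto simp: W'_def polygon_def tris_def)
    qed
    have "chord W' p q"
      unfolding chord_def
    proof (intro conjI)
      show "p \<in> W'" "q \<in> W'" using pqW by (auto simp: W'_def)
      show "(p, q) \<in> E" using pq(1) s by (auto simp: tris_def polygon_def)
      show "(p, q) \<notin> arcs W'" using k by (auto simp: arcs_def W'_def)
      show "(q, p) \<notin> arcs W'"
        using arcs_subset[of q p W' W] pqW arcs_asym[OF _ arc] W by (auto simp: W'_def polygon_def)
    qed
    from inner_split(1)[OF this] have "inner W' = insert t X"
      using W h1 h2 inner_tri[OF t] by auto
    then show ?thesis using W' by blast
  qed
qed

lemma bij_betw_inner: "bij_betw inner {W. polygon W} {X. conn adj tris X}"
proof (rule bij_betw_imageI)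
  show "inj_on inner {W. polygon W}" using inner_inject by (intro inj_onI) simp
  show "inner ` {W. polygon W} = {X. conn adj tris X}"
    using conn_inner conn_imp_inner by blast
qed

definition csplit :: "nat set \<Rightarrow> nat set \<Rightarrow> nat set \<Rightarrow> bool" where
  "csplit W1 W2 W \<longleftrightarrow> (\<exists>p q. chord W p q \<and> W1 = half W p q \<and> W2 = half W q p)"

text \<open>An arc of \<open>W1\<close> that is not one of \<open>W\<close> is a chord of
  \<open>W\<close> with \<open>W1\<close> on one side. If \<open>W2\<close> were not on the other
  side, it would share with \<open>W1\<close> the triangle at this arc. Both inclusions into the
  halves are then equalities, as the triangles of \<open>W1\<close> and \<open>W2\<close> use up
  those of \<open>W\<close>.\<close>

lemma dsplit_inner_imp_csplit:
  assumes W: "polygon W1" "polygon W2" "polygon W" and d: "dsplit (inner W1) (inner W2) (inner W)"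
  shows "csplit W1 W2 W"
proof -
  have dis: "inner W1 \<inter> inner W2 = {}" and un: "inner W = inner W1 \<union> inner W2"
    using d by (auto simp: dsplit_def)
  have sub: "W1 \<subseteq> W" "W2 \<subseteq> W" using un Union_inner W by blast+
  have "W1 \<noteq> W" using dis un conn_nonempty[OF conn_inner[OF W(2)]] by auto
  then obtain p q where pq: "(p, q) \<in> arcs W1" "(p, q) \<notin> arcs W"
    using arcs_new[OF polygon_finite[OF W(3)], of W1] sub W by (auto simp: polygon_def)
  have ch: "chord W p q" using polygon_arc_notin_chord[OF W(1) sub(1) pq] .
  note qp = chord_sym[OF ch] and ne = chord_neq[OF ch]
  have pqW: "p \<in> W" "q \<in> W" "(p, q) \<in> E" using ch by (auto simp: chord_def)
  have W1H: "W1 \<subseteq> half W p q" using arc_subset_half[OF pq(1) sub(1)] .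
  obtain s where s: "s \<in> inner W1" "(p, q) \<in> arcs s" using arc_inner[OF W(1) pq(1)] .
  obtain t where t: "t \<in> inner (half W q p)" "(q, p) \<in> arcs t"
    using arc_inner[OF chord_half_polygon[OF W(3) qp] half_arc[OF pqW(2,1) ne[symmetric]]] .
  have t2: "t \<in> inner W2"
    using t un inner_split[OF ch] inner_mono[OF W1H] by blast
  obtain k where k: "t = {q, p, k}" "cyc p k q" using tris_arc[of t q p] t by (auto simp: inner_def)
  have pq2: "p \<in> W2" "q \<in> W2" "k \<in> W2" using t2 k by (auto simp: inner_def)
  have W2H: "W2 \<subseteq> half W q p"
  proof (rule ccontr)
    assume "\<not> ?thesis"
    then obtain z where z: "z \<in> W2" "cyc q z p" using sub(2) by (auto simp: half_def)
    have c2: "chord W2 p q" using pq2 z k pqW by (auto simp: chord_def arcs_def)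
    obtain u where u: "u \<in> inner (half W2 p q)" "(p, q) \<in> arcs u"
      using arc_inner[OF chord_half_polygon[OF W(2) c2] half_arc[OF pq2(1,2) ne]] .
    have "u = s" using tris_unique[OF _ _ u(2) s(2)] u s by (auto simp: inner_def)
    then show False using u(1) s(1) inner_mono[OF half_subset, of W2 p q] dis by blast
  qed
  have "inner W1 = inner (half W p q)" "inner W2 = inner (half W q p)"
    using inner_mono[OF W1H] inner_mono[OF W2H] inner_split[OF ch] un by blast+
  then show ?thesis
    using inner_inject W chord_half_polygon[OF W(3) ch] chord_half_polygon[OF W(3) qp] ch
    unfolding csplit_def by blast
qed

lemma csplit_iff_dsplit:
  assumes "polygon W1" "polygon W2" "polygon W"
  shows "csplit W1 W2 W \<longleftrightarrow> dsplit (inner W1) (inner W2) (inner W)"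
proof
  assume "csplit W1 W2 W"
  then obtain p q where "chord W p q" "W1 = half W p q" "W2 = half W q p"
    by (auto simp: csplit_def)
  then show "dsplit (inner W1) (inner W2) (inner W)"
    using inner_split[of W p q] by (simp add: dsplit_def)
qed (rule dsplit_inner_imp_csplit[OF assms])

lemma biclosed_iff_bic: "biclosed P \<longleftrightarrow> bic {W. polygon W} csplit P"
proof
  assume P: "biclosed P"
  then show "bic {W. polygon W} csplit P"
    unfolding biclosed_def bic_def closed_def coclosed_def csplit_def by blast
next
  assume P: "bic {W. polygon W} csplit P"
  have "(half W p q \<in> P \<and> half W q p \<in> P \<longrightarrow> W \<in> P) \<and> (W \<in> P \<longrightarrow> half W p q \<in> P \<or> half W q p \<in> P)"
    if W: "polygon W" "chord W p q" for W p q
  proof -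
    have "csplit (half W p q) (half W q p) W" using W by (auto simp: csplit_def)
    then show ?thesis
      using P W(1) chord_half_polygon[OF W] chord_half_polygon[OF W(1) chord_sym[OF W(2)]]
      unfolding bic_def by blast
  qed
  moreover have "P \<subseteq> Collect polygon" using P by (simp add: bic_def)
  ultimately show "biclosed P"
    unfolding biclosed_def closed_def coclosed_def by blast
qed

lemma card_biclosed_eq:
  "card {P. biclosed P} = card {P. bic {X. conn adj tris X} dsplit P}"
  unfolding biclosed_iff_bic
  by (rule card_bic_transfer[OF bij_betw_inner]) (simp add: csplit_iff_dsplit)

end

section \<open>Triangulations of a convex polygon\<close>

definition edge_rel :: "nat \<Rightarrow> (nat \<times> nat) set \<Rightarrow> (nat \<times> nat) set" where
  "edge_rel N D = {(u, v). {u, v} \<in> skeleton_edges N D}"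

lemma edge_rel_iff:
  "(u, v) \<in> edge_rel N D \<longleftrightarrow>
    u < N \<and> v = (u + 1) mod N \<or> v < N \<and> u = (v + 1) mod N \<or> (u, v) \<in> D \<or> (v, u) \<in> D"
  by (auto simp: edge_rel_def skeleton_edges_def polygon_sides_def doubleton_eq_iff)

lemma arcs_interval:
  assumes "3 \<le> N"
  shows "(u, v) \<in> arcs {0..<N} \<longleftrightarrow> u < N \<and> v = (u + 1) mod N"
proof
  assume a: "(u, v) \<in> arcs {0..<N}"
  then have u: "u < N" "v < N" "u \<noteq> v" by (auto dest: arcsD)
  define s where "s = (u + 1) mod N"
  have "s < N" "s \<noteq> u" "u + 1 < N \<and> s = u + 1 \<or> u + 1 = N \<and> s = 0"
    using assms u by (auto simp: s_def mod_Suc)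
  moreover from this have "\<not> cyc u s v" using arcsD(4)[OF a, of s] by auto
  ultimately have "v = s" using u unfolding cyc_def by auto
  then show "u < N \<and> v = (u + 1) mod N" using u by (simp add: s_def)
next
  assume u: "u < N \<and> v = (u + 1) mod N"
  then have "v < N" "u + 1 < N \<and> v = u + 1 \<or> u + 1 = N \<and> v = 0"
    using assms by (auto simp: mod_Suc)
  then show "(u, v) \<in> arcs {0..<N}"
    using assms u by (intro arcsI) (auto simp: cyc_def)
qed

lemma edge_rel_iff_arcs:
  assumes "3 \<le> N"
  shows "(u, v) \<in> edge_rel N D \<longleftrightarrow>
    (u, v) \<in> arcs {0..<N} \<or> (v, u) \<in> arcs {0..<N} \<or> (u, v) \<in> D \<or> (v, u) \<in> D"
  using assms by (simp add: edge_rel_iff arcs_interval)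

lemma diagonal_between:
  assumes "is_diagonal N (p, q)"
  shows "p < q" "q < N" "cyc p (p + 1) q" "\<exists>w<N. cyc q w p"
proof -
  have d: "p + 2 \<le> q" "q < N" "\<not> (p = 0 \<and> q = N - 1)" using assms by (auto simp: is_diagonal_def)
  show "p < q" "q < N" "cyc p (p + 1) q" using d by (auto simp: cyc_def)
  show "\<exists>w<N. cyc q w p"
  proof (cases "p = 0")
    case True
    then show ?thesis using d by (intro exI[of _ "N - 1"]) (auto simp: cyc_def)
  next
    case False
    then show ?thesis using d by (intro exI[of _ 0]) (auto simp: cyc_def)
  qed
qed

lemma edge_rel_bounds:
  assumes N: "3 \<le> N" and tri: "is_triangulation N D" and uv: "(u, v) \<in> edge_rel N D"
  shows "u < N \<and> v < N \<and> u \<noteq> v"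
proof -
  have diag: "is_diagonal N d" if "d \<in> D" for d using tri that by (auto simp: is_triangulation_def)
  show ?thesis
    using uv diag[of "(u, v)"] diag[of "(v, u)"] diagonal_between(1,2)[of N u v]
      diagonal_between(1,2)[of N v u]
    by (auto simp: edge_rel_iff_arcs[OF N] dest: arcsD)
qed

lemma triangulation_outerplanar:
  assumes N: "3 \<le> N" and tri: "is_triangulation N D"
  shows "outerplanar {0..<N} (edge_rel N D)"
proof
  show "finite {0..<N}" by simp
  fix u v assume uv: "(u, v) \<in> edge_rel N D"
  show "u \<in> {0..<N}" "u \<noteq> v" using edge_rel_bounds[OF N tri uv] by auto
  show "(v, u) \<in> edge_rel N D" using uv by (auto simp: edge_rel_iff)
next
  fix p q r s
  assume pq: "(p, q) \<in> edge_rel N D" and rs: "(r, s) \<in> edge_rel N D" and c: "cyc p r q"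
  have diag: "is_diagonal N d" if "d \<in> D" for d using tri that by (auto simp: is_triangulation_def)
  note E_V = edge_rel_bounds[OF N tri]
  have lt: "u < v" if "(u, v) \<in> D" for u v using diagonal_between(1) diag[OF that] by blast
  show "\<not> cyc q s p"
  proof
    assume c2: "cyc q s p"
    \<comment> \<open>A side of the polygon has no vertex behind it, so crossing edges must both be
      diagonals.\<close>
    have side: "(u, v) \<notin> arcs {0..<N}" if "cyc u w v" "w < N" for u v w
      using arcsD(4)[of u v "{0..<N}" w] that by auto
    have "cyc r q s" "cyc s p r" using c c2 by (auto simp: cyc_def)
    then have "(p, q) \<in> D \<or> (q, p) \<in> D" "(r, s) \<in> D \<or> (s, r) \<in> D"
      using pq rs side c c2 E_V[OF pq] E_V[OF rs] by (auto simp: edge_rel_iff_arcs[OF N])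
    moreover have "\<not> (i < k \<and> k < j \<and> j < l)" if "(i, j) \<in> D" "(k, l) \<in> D" for i j k l
      using tri that by (auto simp: is_triangulation_def noncrossing_def)
    ultimately show False using c c2 lt unfolding cyc_def by (smt (verit) less_asym less_trans)
  qed
qed

lemma triangulation_triangulated:
  assumes N: "3 \<le> N" and tri: "is_triangulation N D"
  shows "triangulated {0..<N} (edge_rel N D)"
proof -
  interpret outerplanar "{0..<N}" "edge_rel N D" by (rule triangulation_outerplanar[OF assms])
  have "chords {0..<N} = D"
  proof (intro subset_antisym subrelI)
    fix p q assume "(p, q) \<in> chords {0..<N}"
    then have "p < q" "chord {0..<N} p q" by (auto simp: chords_def)
    then have "(p, q) \<in> D \<or> (q, p) \<in> D" by (auto simp: chord_def edge_rel_iff_arcs[OF N])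
    moreover have "(q, p) \<notin> D"
      using diagonal_between(1)[of N q p] \<open>p < q\<close> tri by (auto simp: is_triangulation_def)
    ultimately show "(p, q) \<in> D" by simp
  next
    fix p q assume d: "(p, q) \<in> D"
    then have "is_diagonal N (p, q)" using tri by (auto simp: is_triangulation_def)
    note b = diagonal_between[OF this]
    obtain w where w: "w < N" "cyc q w p" using b(4) by blast
    have "(p, q) \<notin> arcs {0..<N}" "(q, p) \<notin> arcs {0..<N}"
      using arcsD(4)[of p q "{0..<N}" "p + 1"] arcsD(4)[of q p "{0..<N}" w] b w by auto
    then show "(p, q) \<in> chords {0..<N}"
      using b d by (auto simp: chords_def chord_def edge_rel_iff)
  qed
  then have t: "tight {0..<N}" using tri N by (simp add: tight_def is_triangulation_def)
  have pV: "polygon {0..<N}"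
    using N by (auto simp: polygon_def edge_rel_iff_arcs)
  show ?thesis
  proof
    fix W assume W: "polygon W" "card W \<noteq> 3"
    have "W \<subseteq> {0..<N}" using W by (simp add: polygon_def)
    then show "\<exists>p q. chord W p q"
      using tight_chord_ex[OF tight_polygon[OF t pV W(1)] W(2)] by metis
  qed
qed

lemma card_maximal_separated_eq:
  assumes N: "3 \<le> N" and tri: "is_triangulation N D"
  shows "card {S. maximal_separated_collection (skeleton_edges N D) S} =
    card {P. bic {X. conn (dual_adj D) (triangles N D) X} dsplit P}"
proof -
  interpret triangulated "{0..<N}" "edge_rel N D" by (rule triangulation_triangulated[OF assms])
  have E: "{u, v} \<in> skeleton_edges N D \<longleftrightarrow> (u, v) \<in> edge_rel N D" for u v
    by (simp add: edge_rel_def)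
  have tris: "triangles N D = tris"
  proof (intro subset_antisym subsetI)
    fix t assume "t \<in> triangles N D"
    then show "t \<in> tris"
      by (auto simp: triangles_def tris_def polygon_def arcs_def E)
  next
    fix t assume t: "t \<in> tris"
    then show "t \<in> triangles N D"
      using tris_edge(1)[OF t] by (auto simp: triangles_def tris_def polygon_def E)
  qed
  have adj: "dual_adj D s t \<longleftrightarrow> adj s t" if st: "s \<in> tris" "t \<in> tris" for s t
  proof
    assume d: "dual_adj D s t"
    then obtain i j where ij: "(i, j) \<in> D" "{i, j} \<subseteq> s \<inter> t" "s \<noteq> t" by (auto simp: dual_adj_def)
    then have "i \<noteq> j" using tri by (auto simp: is_triangulation_def is_diagonal_def)
    then show "adj s t" using ij by (auto simp: adj_def)
  next
    assume a: "adj s t"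
    then obtain p q where pq: "p \<noteq> q" "p \<in> s \<inter> t" "q \<in> s \<inter> t" "s \<noteq> t" by (auto simp: adj_def)
    have sub: "s \<subseteq> {0..<N}" "t \<subseteq> {0..<N}" using st by (auto simp: tris_def polygon_def)
    \<comment> \<open>\<open>adj\<close> asks for two common vertices only. They cannot span a side
      of the polygon, because such a side is an arc of both triangles in the same direction, and
      only one triangle lies behind it.\<close>
    have "(u, v) \<notin> arcs {0..<N}" if "u \<in> s \<inter> t" "v \<in> s \<inter> t" for u v
      using arcs_subset[of u v "{0..<N}" s] arcs_subset[of u v "{0..<N}" t] sub that
        tris_unique[OF st] pq(4) by auto
    then have "(p, q) \<in> D \<or> (q, p) \<in> D"
      using tris_edge(1)[OF st(1), of p q] pq by (auto simp: edge_rel_iff_arcs[OF N])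
    then show "dual_adj D s t" using pq by (auto simp: dual_adj_def)
  qed
  have "card {S. maximal_separated_collection (skeleton_edges N D) S} =
      card {P. bic {X. conn adj tris X} dsplit P}"
    using card_maximal_collections[OF E] card_biclosed_eq by simp
  also have "\<dots> = card {P. bic {X. conn (dual_adj D) (triangles N D) X} dsplit P}"
    using card_bic_conn_iso[of id tris tris adj "dual_adj D"] adj tris by simp
  finally show ?thesis .
qed

section \<open>Pairs of nested monotone relations\<close>

text \<open>A pair of partitions, one inside the other, read row by row. The bounds are the lengths
  of the previous rows, so the count satisfies a recursion over the number of rows.\<close>

fun nested :: "nat \<Rightarrow> nat \<Rightarrow> (nat \<times> nat) list \<Rightarrow> bool" where
  "nested c d [] \<longleftrightarrow> True"
| "nested c d ((k, l) # ps) \<longleftrightarrow> k \<le> c \<and> l \<le> d \<and> k \<le> l \<and> nested k l ps"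

definition nested_lists :: "nat \<Rightarrow> nat \<Rightarrow> nat \<Rightarrow> (nat \<times> nat) list set" where
  "nested_lists m c d = {ps. length ps = m \<and> nested c d ps}"

text \<open>The Lindstroem-Gessel-Viennot determinant for two non-intersecting lattice paths; the last
  factor equals \<open>(m + d) choose (m - 1)\<close>, but is also correct for \<open>m = 0\<close>.\<close>
definition nested_count :: "nat \<Rightarrow> nat \<Rightarrow> nat \<Rightarrow> int" where
  "nested_count m c d = int ((m + c) choose m) * int ((m + d) choose m)
     - int ((m + c) choose Suc m) * int ((m + d) choose Suc d)"

lemma nested_count_inner_sum:
  "k \<le> Suc d \<Longrightarrow> (\<Sum>l = k..d. nested_count m k l) =
    int ((m + k) choose m) * int (Suc (m + d) choose Suc m)
    - int ((m + k) choose Suc m) * int (Suc (m + d) choose Suc d)"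
proof (induction d)
  case 0
  then show ?case
    by (cases "k = 0") (auto simp: nested_count_def le_Suc_eq)
next
  case (Suc d)
  show ?case
  proof (cases "k = Suc (Suc d)")
    case True
    have "(m + k) choose k = (m + k) choose m"
      using binomial_symmetric[of k "m + k"] by simp
    then show ?thesis using True by simp
  next
    case False
    then show ?thesis using Suc by (simp add: nested_count_def algebra_simps)
  qed
qed

lemma nested_count_sum:
  "c \<le> d \<Longrightarrow> (\<Sum>k\<le>c. \<Sum>l = k..d. nested_count m k l) = nested_count (Suc m) c d"
proof (induction c)
  case 0
  then show ?case by (simp add: nested_count_inner_sum) (simp add: nested_count_def binomial_eq_0)
next
  case (Suc c)
  then show ?case by (simp add: nested_count_inner_sum) (simp add: nested_count_def algebra_simps)
qed

lemma nested_lists_0: "nested_lists 0 c d = {[]}"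
  by (auto simp: nested_lists_def)

lemma nested_lists_Suc:
  "nested_lists (Suc m) c d =
    (\<lambda>((k, l), ps). (k, l) # ps) ` (SIGMA p:(SIGMA k:{..c}. {k..d}). nested_lists m (fst p) (snd p))"
proof (intro subset_antisym subsetI)
  fix ps assume "ps \<in> nested_lists (Suc m) c d"
  then obtain k l qs where "ps = (k, l) # qs" "length qs = m" "k \<le> c" "l \<le> d" "k \<le> l" "nested k l qs"
    by (auto simp: nested_lists_def length_Suc_conv)
  then show "ps \<in> (\<lambda>((k, l), ps). (k, l) # ps) `
      (SIGMA p:(SIGMA k:{..c}. {k..d}). nested_lists m (fst p) (snd p))"
    by (intro image_eqI[of _ _ "((k, l), qs)"]) (auto simp: nested_lists_def)
qed (auto simp: nested_lists_def)

lemma finite_nested_lists: "finite (nested_lists m c d)"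
  by (induction m arbitrary: c d) (auto simp: nested_lists_0 nested_lists_Suc)

lemma card_nested_lists: "c \<le> d \<Longrightarrow> int (card (nested_lists m c d)) = nested_count m c d"
proof (induction m arbitrary: c d)
  case 0
  then show ?case by (simp add: nested_lists_0 nested_count_def)
next
  case (Suc m)
  have "card (nested_lists (Suc m) c d) =
      card (SIGMA p:(SIGMA k:{..c}. {k..d}). nested_lists m (fst p) (snd p))"
    unfolding nested_lists_Suc by (rule card_image) (auto simp: inj_on_def)
  also have "int \<dots> = (\<Sum>p\<in>(SIGMA k:{..c}. {k..d}). int (card (nested_lists m (fst p) (snd p))))"
    by (simp add: finite_nested_lists)
  also have "\<dots> = (\<Sum>(k, l)\<in>(SIGMA k:{..c}. {k..d}). nested_count m k l)"
    by (intro sum.cong) (auto simp: Suc.IH)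
  also have "\<dots> = (\<Sum>k\<le>c. \<Sum>l = k..d. nested_count m k l)"
    by (simp add: sum.Sigma)
  also have "\<dots> = nested_count (Suc m) c d" using Suc.prems by (rule nested_count_sum)
  finally show ?case .
qed

lemma nested_iff:
  "nested c d ps \<longleftrightarrow> sorted_wrt (\<lambda>p q. fst q \<le> fst p \<and> snd q \<le> snd p) ps \<and>
    (\<forall>p\<in>set ps. fst p \<le> c \<and> snd p \<le> d \<and> fst p \<le> snd p)"
proof (induction ps arbitrary: c d)
  case (Cons p ps)
  obtain k l where "p = (k, l)" by force
  then show ?case using Cons.IH[of k l] by fastforce
qed simp

section \<open>Monotone relations as partitions\<close>

definition mono_rel :: "nat \<Rightarrow> nat \<Rightarrow> (nat \<times> nat) set \<Rightarrow> bool" where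
  "mono_rel A n M \<longleftrightarrow> M \<subseteq> {..<A} \<times> {A..<n} \<and>
     (\<forall>x y x' y'. (x, y) \<in> M \<longrightarrow> x' \<le> x \<longrightarrow> y \<le> y' \<longrightarrow> y' < n \<longrightarrow> (x', y') \<in> M)"

text \<open>A Ferrers diagram with row lengths \<open>ks\<close>, flushed to the right
  margin.\<close>

definition rel_of :: "nat \<Rightarrow> nat list \<Rightarrow> (nat \<times> nat) set" where
  "rel_of n ks = {(x, y). x < length ks \<and> n \<le> y + ks ! x \<and> y < n}"

lemma rel_of_subset_iff:
  assumes "length ks = length ls" "\<And>x. x < length ks \<Longrightarrow> ks ! x \<le> n"
  shows "rel_of n ks \<subseteq> rel_of n ls \<longleftrightarrow> (\<forall>x<length ks. ks ! x \<le> ls ! x)"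
proof
  assume s: "rel_of n ks \<subseteq> rel_of n ls"
  show "\<forall>x<length ks. ks ! x \<le> ls ! x"
  proof (intro allI impI)
    fix x assume x: "x < length ks"
    show "ks ! x \<le> ls ! x"
    proof (cases "ks ! x = 0")
      case False
      \<comment> \<open>This is the first column of row \<open>x\<close>; its membership in the
        larger relation bounds the row length there.\<close>
      then have "(x, n - ks ! x) \<in> rel_of n ks" using x assms(2)[OF x] by (auto simp: rel_of_def)
      then have "(x, n - ks ! x) \<in> rel_of n ls" using s by blast
      then show ?thesis using assms(2)[OF x] by (auto simp: rel_of_def)
    qed simp
  qed
next
  assume le: "\<forall>x<length ks. ks ! x \<le> ls ! x"
  show "rel_of n ks \<subseteq> rel_of n ls"
  proof clarify
    fix x y assume "(x, y) \<in> rel_of n ks"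
    moreover from this have "ks ! x \<le> ls ! x" using le by (auto simp: rel_of_def)
    ultimately show "(x, y) \<in> rel_of n ls" using assms(1) by (auto simp: rel_of_def)
  qed
qed

lemma mono_rel_of:
  assumes "length ks = A" "sorted_wrt (\<ge>) ks" "\<And>k. k \<in> set ks \<Longrightarrow> A + k \<le> n"
  shows "mono_rel A n (rel_of n ks)"
proof -
  have anti: "ks ! x \<le> ks ! x'" if "x' \<le> x" "x < A" for x x'
    using sorted_wrt_nth_less[OF assms(2), of x' x] that assms(1) by (cases "x = x'") auto
  have le: "A + ks ! x \<le> n" if "x < A" for x
    using assms(1) assms(3)[OF nth_mem] that by simp
  show ?thesis
    unfolding mono_rel_def
  proof (intro conjI allI impI subsetI)
    fix z assume "z \<in> rel_of n ks"
    then obtain x y where z: "z = (x, y)" "x < A" "n \<le> y + ks ! x" "y < n"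
      using assms(1) by (auto simp: rel_of_def)
    then show "z \<in> {..<A} \<times> {A..<n}" using le[OF z(2)] by auto
  next
    fix x y x' y' assume "(x, y) \<in> rel_of n ks" "x' \<le> x" "y \<le> y'" "y' < n"
    then show "(x', y') \<in> rel_of n ks"
      using anti[of x' x] assms(1) by (auto simp: rel_of_def)
  qed
qed

text \<open>Each row is a final segment of the columns below \<open>n\<close>, so the row lengths
  determine the relation. The alternative \<open>k = 0\<close> covers \<open>n < A\<close>, where
  the relation is empty.\<close>

lemma mono_rel_obtains:
  assumes "mono_rel A n M"
  obtains ks where "length ks = A" "sorted_wrt (\<ge>) ks" "\<forall>k\<in>set ks. A + k \<le> n \<or> k = 0" "M = rel_of n ks"
proof -
  define f where "f x = card {y. (x, y) \<in> M}" for x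
  have M: "M \<subseteq> {..<A} \<times> {A..<n}" using assms by (simp add: mono_rel_def)
  have up: "(x', y') \<in> M" if "(x, y) \<in> M" "x' \<le> x" "y \<le> y'" "y' < n" for x y x' y'
    using assms that unfolding mono_rel_def by blast+
  have row: "{y. (x, y) \<in> M} = {n - f x..<n}" for x
  proof (cases "{y. (x, y) \<in> M} = {}")
    case True then show ?thesis by (simp add: f_def)
  next
    case False
    define m where "m = (LEAST y. (x, y) \<in> M)"
    have m: "(x, m) \<in> M" using False LeastI_ex[of "\<lambda>y. (x, y) \<in> M"] by (auto simp: m_def)
    have "{y. (x, y) \<in> M} = {m..<n}"
    proof (intro subset_antisym subsetI)
      fix y assume "y \<in> {y. (x, y) \<in> M}"
      then show "y \<in> {m..<n}" using M Least_le[of "\<lambda>y. (x, y) \<in> M" y] by (auto simp: m_def)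
    next
      fix y assume "y \<in> {m..<n}"
      then show "y \<in> {y. (x, y) \<in> M}" using up[OF m order_refl] by simp
    qed
    moreover have "m < n" using m M by auto
    ultimately show ?thesis by (simp add: f_def)
  qed
  have fin: "finite {y. (x, y) \<in> M}" for x
    using row[of x] by simp
  have anti: "f x \<le> f x'" if "x' \<le> x" for x x'
    unfolding f_def
  proof (rule card_mono[OF fin], clarify)
    fix y assume y: "(x, y) \<in> M"
    then show "(x', y) \<in> M" using up[OF y that order_refl] M by auto
  qed
  define ks where "ks = map f [0..<A]"
  show ?thesis
  proof
    show "length ks = A" by (simp add: ks_def)
    show "sorted_wrt (\<ge>) ks" using anti by (auto simp: ks_def sorted_wrt_iff_nth_less)
    have "f x \<le> card {A..<n}" for x unfolding f_def using M by (intro card_mono) auto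
    then have fA: "f x \<le> n - A" for x by simp
    have "A + f x \<le> n \<or> f x = 0" for x using fA[of x] by arith
    then show "\<forall>k\<in>set ks. A + k \<le> n \<or> k = 0" by (auto simp: ks_def)
  next
    have "(x, y) \<in> M \<longleftrightarrow> x < A \<and> n - f x \<le> y \<and> y < n" for x y
      using row[of x] M by (auto simp: set_eq_iff)
    then show "M = rel_of n ks" by (auto simp: rel_of_def ks_def)
  qed
qed

definition nested_rels :: "nat \<Rightarrow> nat \<Rightarrow> ((nat \<times> nat) set \<times> (nat \<times> nat) set) set" where
  "nested_rels A n = {(M, M'). mono_rel A n M \<and> mono_rel A n M' \<and> M \<subseteq> M'}"

lemma card_nested_rels: "int (card (nested_rels A (A + B))) = nested_count A B B"
proof -
  let ?n = "A + B"
  define h where "h ps = (rel_of ?n (map fst ps), rel_of ?n (map snd ps))" for ps :: "(nat \<times> nat) list"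
  have L: "nested_lists A B B = {ps. length ps = A \<and> sorted_wrt (\<ge>) (map fst ps) \<and>
      sorted_wrt (\<ge>) (map snd ps) \<and> (\<forall>x<A. fst (ps ! x) \<le> snd (ps ! x) \<and> snd (ps ! x) \<le> B)}"
    by (auto simp: nested_lists_def nested_iff sorted_wrt_iff_nth_less all_set_conv_all_nth)
  have "bij_betw h (nested_lists A B B) (nested_rels A ?n)"
  proof (rule bij_betw_imageI)
    show "inj_on h (nested_lists A B B)"
    proof (rule inj_onI)
      fix ps qs assume ps: "ps \<in> nested_lists A B B" and qs: "qs \<in> nested_lists A B B" and eq: "h ps = h qs"
      have len: "length ps = A" "length qs = A" using ps qs by (auto simp: L)
      have b: "fst (ps ! x) \<le> ?n \<and> snd (ps ! x) \<le> ?n \<and> fst (qs ! x) \<le> ?n \<and> snd (qs ! x) \<le> ?n" if "x < A" for x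
        using ps qs that by (fastforce simp: L)
      have "fst (ps ! x) = fst (qs ! x)" "snd (ps ! x) = snd (qs ! x)" if "x < A" for x
        using rel_of_subset_iff[of "map fst ps" "map fst qs" ?n] rel_of_subset_iff[of "map fst qs" "map fst ps" ?n]
          rel_of_subset_iff[of "map snd ps" "map snd qs" ?n] rel_of_subset_iff[of "map snd qs" "map snd ps" ?n]
          eq len b that by (auto simp: h_def intro: le_antisym)
      then show "ps = qs" using len by (auto simp: list_eq_iff_nth_eq prod_eq_iff)
    qed
    show "h ` nested_lists A B B = nested_rels A ?n"
    proof (intro subset_antisym subsetI)
      fix z assume "z \<in> h ` nested_lists A B B"
      then obtain ps where ps: "ps \<in> nested_lists A B B" "z = h ps" by blast
      have len: "length ps = A" using ps by (simp add: L)
      have bd: "fst p \<le> B \<and> snd p \<le> B \<and> fst p \<le> snd p" if "p \<in> set ps" for p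
        using ps(1) that by (auto simp: nested_lists_def nested_iff)
      have b: "fst (ps ! x) \<le> B \<and> snd (ps ! x) \<le> B \<and> fst (ps ! x) \<le> snd (ps ! x)" if "x < A" for x
        using bd nth_mem[of x ps] len that by blast
      have "mono_rel A ?n (rel_of ?n (map fst ps))" "mono_rel A ?n (rel_of ?n (map snd ps))"
        using ps(1) bd by (auto simp: L intro!: mono_rel_of)
      moreover have "rel_of ?n (map fst ps) \<subseteq> rel_of ?n (map snd ps)"
        using b len by (subst rel_of_subset_iff) (auto intro: trans_le_add2)
      ultimately show "z \<in> nested_rels A ?n" using ps(2) by (simp add: nested_rels_def h_def)
    next
      fix z assume "z \<in> nested_rels A ?n"
      then obtain M M' where z: "z = (M, M')" "mono_rel A ?n M" "mono_rel A ?n M'" "M \<subseteq> M'"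
        by (auto simp: nested_rels_def)
      obtain ks where ks: "length ks = A" "sorted_wrt (\<ge>) ks" "\<forall>k\<in>set ks. A + k \<le> ?n \<or> k = 0"
        "M = rel_of ?n ks" using mono_rel_obtains[OF z(2)] .
      obtain ls where ls: "length ls = A" "sorted_wrt (\<ge>) ls" "\<forall>k\<in>set ls. A + k \<le> ?n \<or> k = 0"
        "M' = rel_of ?n ls" using mono_rel_obtains[OF z(3)] .
      have b: "ks ! x \<le> B" "ls ! x \<le> B" if "x < A" for x
        using ks(3) ls(3) nth_mem[of x ks] nth_mem[of x ls] ks(1) ls(1) that by fastforce+
      have "ks ! x \<le> ls ! x" if "x < A" for x
      proof -
        have "ks ! x \<le> ?n" if "x < A" for x using b(1)[OF that] by simp
        then show ?thesis using rel_of_subset_iff[of ks ls ?n] z(4) ks ls that by simp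
      qed
      then have "zip ks ls \<in> nested_lists A B B"
        using ks ls b by (auto simp: L)
      moreover have "z = h (zip ks ls)" using z ks ls by (simp add: h_def)
      ultimately show "z \<in> h ` nested_lists A B B" by blast
    qed
  qed
  then show ?thesis
    using card_nested_lists[of B B A] bij_betw_same_card by fastforce
qed

text \<open>The variables stand for \<open>a + 1\<close>, \<open>b + 1\<close> and the factorials of
  \<open>a\<close>, \<open>b\<close> and \<open>a + b + 2\<close>; with the factorials unfolded this
  far, the identity is one of rational functions.\<close>

lemma nested_count_fact_aux:
  fixes x y p q F :: real
  assumes "x > 0" "y > 0" "p > 0" "q > 0"
  shows "(F / (x * p * (y * q)) * (F / (x * p * (y * q))) -
      F / ((x + 1) * x * p * q) * (F / ((y + 1) * y * q * p))) * (x * p) * (y * q) =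
    (x + y + 1) * (F / ((y + 1) * y * q)) * (F / ((x + 1) * x * p))"
proof -
  have "x + 1 \<noteq> 0" "y + 1 \<noteq> 0" using assms by linarith+
  then show ?thesis using assms by (simp add: divide_simps) algebra
qed

lemma nested_count_fact:
  "nested_count (Suc a) (Suc b) (Suc b) * int (fact (Suc a)) * int (fact (Suc b)) =
    int ((a + b + 3) * (fact (a + b + 2) div fact (b + 2)) * (fact (a + b + 2) div fact (a + 2)))"
proof -
  have e: "real (Suc a + Suc b choose Suc a) = fact (a + b + 2) / (fact (Suc a) * fact (Suc b))"
    using binomial_fact[of "Suc a" "Suc a + Suc b", where 'a = real] by (simp add: numeral_2_eq_2)
  have e2: "real (Suc a + Suc b choose Suc (Suc a)) = fact (a + b + 2) / (fact (Suc (Suc a)) * fact b)"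
    using binomial_fact[of "Suc (Suc a)" "Suc a + Suc b", where 'a = real] by (simp add: numeral_2_eq_2)
  have e3: "real (Suc a + Suc b choose Suc (Suc b)) = fact (a + b + 2) / (fact (Suc (Suc b)) * fact a)"
    using binomial_fact[of "Suc (Suc b)" "Suc a + Suc b", where 'a = real] by (simp add: numeral_2_eq_2)
  \<comment> \<open>The natural-number quotients are exact, so they may be computed over the
    reals.\<close>
  have d: "real (fact (a + b + 2) div fact (b + 2)) = fact (a + b + 2) / fact (b + 2)"
    using real_of_nat_div[OF fact_dvd[of "b + 2" "a + b + 2"]] by (simp only: of_nat_fact le_add2 add.assoc)
  have d2: "real (fact (a + b + 2) div fact (a + 2)) = fact (a + b + 2) / fact (a + 2)"
    using real_of_nat_div[OF fact_dvd[of "a + 2" "a + b + 2"]] by (simp only: of_nat_fact)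
  have "real_of_int (nested_count (Suc a) (Suc b) (Suc b) * int (fact (Suc a)) * int (fact (Suc b))) =
    real_of_int (int ((a + b + 3) * (fact (a + b + 2) div fact (b + 2)) * (fact (a + b + 2) div fact (a + 2))))"
    unfolding nested_count_def of_int_mult of_int_diff of_int_of_nat_eq of_nat_mult e e2 e3 d d2
    using nested_count_fact_aux[of "real a + 1" "real b + 1" "fact a" "fact b" "fact (a + b + 2)"]
    by (simp add: numeral_2_eq_2 numeral_3_eq_3 add.commute add.left_commute del: fact_Suc)
      (simp add: ac_simps)
  then show ?thesis by (simp only: of_int_eq_iff)
qed

section \<open>Pairs of linear orders\<close>

text \<open>A permutation of an interval sends \<open>x\<close> to its rank in the induced order, so
  the order determines it.\<close>

lemma permutes_eq_if_same_order:
  fixes l u :: nat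
  assumes p: "p permutes {l..<u}" and q: "q permutes {l..<u}"
    and ord: "\<And>x y. l \<le> x \<Longrightarrow> x < y \<Longrightarrow> y < u \<Longrightarrow> p x < p y \<longleftrightarrow> q x < q y"
  shows "p = q"
proof
  fix x
  show "p x = q x"
  proof (cases "x \<in> {l..<u}")
    case True
    have rank: "f x = l + card {y \<in> {l..<u}. f y < f x}" if f: "f permutes {l..<u}" for f
    proof -
      have "f ` {y \<in> {l..<u}. f y < f x} = {l..<f x}"
      proof (intro subset_antisym subsetI)
        fix z assume "z \<in> f ` {y \<in> {l..<u}. f y < f x}"
        then show "z \<in> {l..<f x}" using permutes_in_image[OF f] by auto
      next
        fix z assume z: "z \<in> {l..<f x}"
        moreover have "f x < u" using permutes_in_image[OF f, of x] True by auto
        ultimately have "z \<in> f ` {l..<u}" using permutes_image[OF f] by auto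
        then show "z \<in> f ` {y \<in> {l..<u}. f y < f x}" using z by auto
      qed
      moreover have "inj_on f {y \<in> {l..<u}. f y < f x}"
        using permutes_inj[OF f] by (rule inj_on_subset) auto
      ultimately have "card {y \<in> {l..<u}. f y < f x} = f x - l"
        by (metis card_atLeastLessThan card_image)
      moreover have "l \<le> f x" using permutes_in_image[OF f, of x] True by auto
      ultimately show ?thesis by simp
    qed
    have "p y < p x \<longleftrightarrow> q y < q x" if "y \<in> {l..<u}" for y
    proof (cases x y rule: linorder_cases)
      case less
      then have "p x \<noteq> p y" "q x \<noteq> q y" using permutes_inj[OF p] permutes_inj[OF q] by (simp_all add: inj_eq)
      then show ?thesis using ord[of x y] less True that by auto
    qed (use ord[of y x] True that in auto)
    then have "{y \<in> {l..<u}. p y < p x} = {y \<in> {l..<u}. q y < q x}" by blast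
    then show ?thesis using rank[OF p] rank[OF q] by simp
  next
    case False
    then show ?thesis using p q by (simp add: permutes_def)
  qed
qed

lemma rank_permutes:
  fixes l u :: nat
  assumes irrefl: "\<And>x. x \<in> {l..<u} \<Longrightarrow> \<not> R x x"
    and trans: "\<And>x y z. x \<in> {l..<u} \<Longrightarrow> y \<in> {l..<u} \<Longrightarrow> z \<in> {l..<u} \<Longrightarrow> R x y \<Longrightarrow> R y z \<Longrightarrow> R x z"
    and total: "\<And>x y. x \<in> {l..<u} \<Longrightarrow> y \<in> {l..<u} \<Longrightarrow> x \<noteq> y \<Longrightarrow> R x y \<or> R y x"
  obtains p where "p permutes {l..<u}" "\<And>x y. x \<in> {l..<u} \<Longrightarrow> y \<in> {l..<u} \<Longrightarrow> R x y \<longleftrightarrow> p x < p y"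
proof -
  let ?S = "{l..<u}"
  define p where "p x = (if x \<in> ?S then l + card {y \<in> ?S. R y x} else x)" for x
  have less: "p x < p y" if "x \<in> ?S" "y \<in> ?S" "R x y" for x y
  proof -
    have "{z \<in> ?S. R z x} \<subset> {z \<in> ?S. R z y}"
      using that trans irrefl by blast
    then have "card {z \<in> ?S. R z x} < card {z \<in> ?S. R z y}" by (intro psubset_card_mono) auto
    then show ?thesis using that by (simp add: p_def)
  qed
  have iff: "R x y \<longleftrightarrow> p x < p y" if "x \<in> ?S" "y \<in> ?S" for x y
    using less[OF that] less[OF that(2,1)] total[OF that] by force
  have "inj_on p ?S"
  proof (rule inj_onI)
    fix x y assume "x \<in> ?S" "y \<in> ?S" "p x = p y"
    then show "x = y" using total[of x y] less[of x y] less[of y x] by force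
  qed
  moreover have "p ` ?S \<subseteq> ?S"
  proof clarify
    fix x assume x: "x \<in> ?S"
    have "{y \<in> ?S. R y x} \<subset> ?S" using x irrefl by blast
    then have "card {y \<in> ?S. R y x} < card ?S" by (intro psubset_card_mono) auto
    then show "p x \<in> ?S" using x by (auto simp: p_def)
  qed
  ultimately have "bij_betw p ?S ?S"
    by (simp add: bij_betw_def endo_inj_surj)
  then have "p permutes ?S" by (rule bij_imp_permutes) (auto simp: p_def)
  then show ?thesis using iff that by blast
qed

text \<open>The relation \<open>s\<close> records a linear order on \<open>{0..<n}\<close> (\<open>s x y\<close> for \<open>x < y\<close> means that \<open>x\<close> precedes
  \<open>y\<close>), and \<open>r\<close> the comparisons of \<open>x < A\<close> with \<open>y \<ge> A\<close> in a second linear order, which agrees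
  with the first one on both sides of \<open>A\<close> and moves the right side up.\<close>
definition shuffle_cond :: "nat \<Rightarrow> nat \<Rightarrow> (nat \<Rightarrow> nat \<Rightarrow> bool) \<Rightarrow> (nat \<Rightarrow> nat \<Rightarrow> bool) \<Rightarrow> bool" where
  "shuffle_cond A n s r \<longleftrightarrow>
    (\<forall>x y z. x < y \<longrightarrow> y < z \<longrightarrow> z < n \<longrightarrow> (s x y \<and> s y z \<longrightarrow> s x z) \<and> (s x z \<longrightarrow> s x y \<or> s y z)) \<and>
    (\<forall>x y. x < A \<longrightarrow> A \<le> y \<longrightarrow> y < n \<longrightarrow> s x y \<longrightarrow> r x y) \<and>
    (\<forall>x y z. x < y \<longrightarrow> y < A \<longrightarrow> A \<le> z \<longrightarrow> z < n \<longrightarrow>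
      (s x y \<and> r y z \<longrightarrow> r x z) \<and> (r x z \<longrightarrow> s x y \<or> r y z)) \<and>
    (\<forall>x y z. x < A \<longrightarrow> A \<le> y \<longrightarrow> y < z \<longrightarrow> z < n \<longrightarrow>
      (r x y \<and> s y z \<longrightarrow> r x z) \<and> (r x z \<longrightarrow> r x y \<or> s y z))"

text \<open>Cross comparisons are stored at the ranks \<open>p x\<close> and \<open>q y\<close>
  instead of at \<open>x\<close> and \<open>y\<close>; transitivity then becomes monotonicity of
  \<open>M\<close>.\<close>

definition shuffle_lt :: "nat \<Rightarrow> (nat \<Rightarrow> nat) \<Rightarrow> (nat \<Rightarrow> nat) \<Rightarrow> (nat \<times> nat) set \<Rightarrow> nat \<Rightarrow> nat \<Rightarrow> bool" where
  "shuffle_lt A p q M x y \<longleftrightarrow> (if y < A then p x < p y else if A \<le> x then q x < q y else (p x, q y) \<in> M)"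

lemma mono_relD:
  "mono_rel A n M \<Longrightarrow> (x, y) \<in> M \<Longrightarrow> x' \<le> x \<Longrightarrow> y \<le> y' \<Longrightarrow> y' < n \<Longrightarrow> (x', y') \<in> M"
  by (simp add: mono_rel_def)

lemma shuffle_cond_shuffle_lt:
  assumes "A \<le> n" and p: "p permutes {0..<A}" and q: "q permutes {A..<n}" and M: "(M, M') \<in> nested_rels A n"
  shows "shuffle_cond A n (shuffle_lt A p q M) (\<lambda>x y. (p x, q y) \<in> M')"
proof -
  have m: "mono_rel A n M" "mono_rel A n M'" "M \<subseteq> M'" using M by (auto simp: nested_rels_def)
  have qn: "q y < n" if "A \<le> y" "y < n" for y using permutes_in_image[OF q, of y] that by auto
  have left: "(p x < p y \<and> (p y, q z) \<in> N \<longrightarrow> (p x, q z) \<in> N) \<and> ((p x, q z) \<in> N \<longrightarrow> p x < p y \<or> (p y, q z) \<in> N)"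
    if "mono_rel A n N" "A \<le> z" "z < n" for x y z N
    using mono_relD[OF that(1), of "p x" "q z" "p y" "q z"] mono_relD[OF that(1), of "p y" "q z" "p x" "q z"]
      qn[OF that(2,3)] by (cases "p x < p y") (auto simp: not_less)
  have right: "((p x, q y) \<in> N \<and> q y < q z \<longrightarrow> (p x, q z) \<in> N) \<and> ((p x, q z) \<in> N \<longrightarrow> (p x, q y) \<in> N \<or> q y < q z)"
    if "mono_rel A n N" "A \<le> y" "y < n" "A \<le> z" "z < n" for x y z N
    using mono_relD[OF that(1), of "p x" "q z" "p x" "q y"] mono_relD[OF that(1), of "p x" "q y" "p x" "q z"]
      qn[OF that(2,3)] qn[OF that(4,5)] by (cases "q y < q z") (auto simp: not_less)
  show ?thesis
    unfolding shuffle_cond_def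
  proof (intro conjI allI impI)
    fix x y z assume o: "x < y" "y < z" "z < n"
    consider "z < A" | "y < A" "A \<le> z" | "x < A" "A \<le> y" | "A \<le> x" using o by linarith
    then have "(shuffle_lt A p q M x y \<and> shuffle_lt A p q M y z \<longrightarrow> shuffle_lt A p q M x z) \<and>
        (shuffle_lt A p q M x z \<longrightarrow> shuffle_lt A p q M x y \<or> shuffle_lt A p q M y z)"
    proof cases
      case 2
      then show ?thesis using o left[OF m(1), of z x y] by (simp add: shuffle_lt_def)
    next
      case 3
      then show ?thesis using o right[OF m(1), of y z x] by (simp add: shuffle_lt_def)
    qed (use o in \<open>auto simp: shuffle_lt_def\<close>)
    then show "shuffle_lt A p q M x y \<and> shuffle_lt A p q M y z \<Longrightarrow> shuffle_lt A p q M x z"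
      "shuffle_lt A p q M x z \<Longrightarrow> shuffle_lt A p q M x y \<or> shuffle_lt A p q M y z"
      by blast+
  next
    fix x y assume "x < A" "A \<le> y" "y < n" "shuffle_lt A p q M x y"
    then show "(p x, q y) \<in> M'" using m(3) by (auto simp: shuffle_lt_def)
  next
    fix x y z assume o: "x < y" "y < A" "A \<le> z" "z < n"
    show "shuffle_lt A p q M x y \<and> (p y, q z) \<in> M' \<Longrightarrow> (p x, q z) \<in> M'"
      "(p x, q z) \<in> M' \<Longrightarrow> shuffle_lt A p q M x y \<or> (p y, q z) \<in> M'"
      using left[OF m(2) o(3,4), of x y] o by (auto simp: shuffle_lt_def)
  next
    fix x y z assume o: "x < A" "A \<le> y" "y < z" "z < n"
    show "(p x, q y) \<in> M' \<and> shuffle_lt A p q M y z \<Longrightarrow> (p x, q z) \<in> M'"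
      "(p x, q z) \<in> M' \<Longrightarrow> (p x, q y) \<in> M' \<or> shuffle_lt A p q M y z"
      using right[OF m(2), of y z x] o by (auto simp: shuffle_lt_def)
  qed
qed

lemma shuffle_cond_obtains:
  assumes "A \<le> n" and cond: "shuffle_cond A n s r"
  obtains p q M M' where "p permutes {0..<A}" "q permutes {A..<n}" "(M, M') \<in> nested_rels A n"
    "\<forall>x y. x < y \<longrightarrow> y < n \<longrightarrow> s x y = shuffle_lt A p q M x y"
    "\<forall>x y. x < A \<longrightarrow> A \<le> y \<longrightarrow> y < n \<longrightarrow> r x y = ((p x, q y) \<in> M')"
proof -
  have C1: "s x y \<Longrightarrow> s y z \<Longrightarrow> s x z" "s x z \<Longrightarrow> \<not> s x y \<Longrightarrow> s y z"
    if "x < y" "y < z" "z < n" for x y z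
    using cond that unfolding shuffle_cond_def by blast+
  have C2: "r x y" if "x < A" "A \<le> y" "y < n" "s x y" for x y
    using cond that unfolding shuffle_cond_def by blast
  have C3: "s x y \<Longrightarrow> r y z \<Longrightarrow> r x z" "r x z \<Longrightarrow> \<not> s x y \<Longrightarrow> r y z"
    if "x < y" "y < A" "A \<le> z" "z < n" for x y z
    using cond that unfolding shuffle_cond_def by blast+
  have C4: "r x y \<Longrightarrow> s y z \<Longrightarrow> r x z" "r x z \<Longrightarrow> \<not> s y z \<Longrightarrow> r x y"
    if "x < A" "A \<le> y" "y < z" "z < n" for x y z
    using cond that unfolding shuffle_cond_def by blast+
  \<comment> \<open>Reading the failure of \<open>s\<close> as the opposite comparison gives a
    tournament. Its transitivity uses the closure condition on \<open>s\<close> for three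
    arrangements of the points and the coclosure condition for the other three.\<close>
  define R where "R x y \<longleftrightarrow> x < y \<and> s x y \<or> y < x \<and> \<not> s y x" for x y
  have trans: "R x z" if b: "x < n" "y < n" "z < n" and R: "R x y" "R y z" for x y z
  proof -
    have "x \<noteq> y" "y \<noteq> z" using R by (auto simp: R_def)
    moreover have "x \<noteq> z" using R by (auto simp: R_def)
    ultimately consider "x < y \<and> y < z" | "x < z \<and> z < y" | "y < x \<and> x < z" | "y < z \<and> z < x"
      | "z < x \<and> x < y" | "z < y \<and> y < x" by linarith
    then show ?thesis
    proof cases
      case 1 then show ?thesis using R b C1(1)[of x y z] by (auto simp: R_def)
    next
      case 2 then show ?thesis using R b C1(2)[of x z y] by (auto simp: R_def)
    next
      case 3 then show ?thesis using R b C1(2)[of y x z] by (auto simp: R_def)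
    next
      case 4 then show ?thesis using R b C1(1)[of y z x] by (auto simp: R_def)
    next
      case 5 then show ?thesis using R b C1(1)[of z x y] by (auto simp: R_def)
    next
      case 6 then show ?thesis using R b C1(2)[of z y x] by (auto simp: R_def)
    qed
  qed
  have irrefl: "\<not> R x x" and total: "x \<noteq> y \<Longrightarrow> R x y \<or> R y x" for x y by (auto simp: R_def)
  obtain p where p: "p permutes {0..<A}" and pR: "\<And>x y. x \<in> {0..<A} \<Longrightarrow> y \<in> {0..<A} \<Longrightarrow> R x y \<longleftrightarrow> p x < p y"
  proof (rule rank_permutes[of 0 A R])
    show "R x z" if "x \<in> {0..<A}" "y \<in> {0..<A}" "z \<in> {0..<A}" "R x y" "R y z" for x y z
      using trans[of x y z] that assms(1) by auto
  qed (use irrefl total in auto)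
  obtain q where q: "q permutes {A..<n}" and qR: "\<And>x y. x \<in> {A..<n} \<Longrightarrow> y \<in> {A..<n} \<Longrightarrow> R x y \<longleftrightarrow> q x < q y"
  proof (rule rank_permutes[of A n R])
    show "R x z" if "x \<in> {A..<n}" "y \<in> {A..<n}" "z \<in> {A..<n}" "R x y" "R y z" for x y z
      using trans[of x y z] that by auto
  qed (use irrefl total in auto)
  \<comment> \<open>Relabelling by ranks turns compatibility with the orders on both sides into
    monotonicity.\<close>
  define G where "G f = {(p x, q y) | x y. x < A \<and> A \<le> y \<and> y < n \<and> f x y}" for f :: "nat \<Rightarrow> nat \<Rightarrow> bool"
  have G_iff: "(p x, q y) \<in> G f \<longleftrightarrow> f x y" if "x < A" "A \<le> y" "y < n" for f x y
    using that permutes_inj[OF p] permutes_inj[OF q] by (auto simp: G_def inj_eq)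
  have pA: "p x < A" if "x < A" for x using permutes_in_image[OF p, of x] that by simp
  have qn: "A \<le> q y \<and> q y < n" if "A \<le> y" "y < n" for y
    using permutes_in_image[OF q, of y] that by simp
  have mono: "mono_rel A n (G f)"
    if L: "\<And>x x' y. x < A \<Longrightarrow> x' < A \<Longrightarrow> A \<le> y \<Longrightarrow> y < n \<Longrightarrow> R x' x \<Longrightarrow> f x y \<Longrightarrow> f x' y"
      and U: "\<And>x y y'. x < A \<Longrightarrow> A \<le> y \<Longrightarrow> y < n \<Longrightarrow> A \<le> y' \<Longrightarrow> y' < n \<Longrightarrow> R y y' \<Longrightarrow> f x y \<Longrightarrow> f x y'" for f
    unfolding mono_rel_def
  proof (intro conjI allI impI)
    show "G f \<subseteq> {..<A} \<times> {A..<n}"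
      using pA qn by (auto simp: G_def)
    fix u v u' v' assume uv: "(u, v) \<in> G f" "u' \<le> u" "v \<le> v'" "v' < n"
    then obtain x y where xy: "u = p x" "v = q y" "x < A" "A \<le> y" "y < n" "f x y" by (auto simp: G_def)
    have "u' \<in> {0..<A}" "v' \<in> {A..<n}"
      using pA[of x] qn[of y] xy uv by auto
    then obtain x' y' where xy': "u' = p x'" "v' = q y'" "x' \<in> {0..<A}" "y' \<in> {A..<n}"
      using permutes_image[OF p] permutes_image[OF q] by (metis imageE)
    have "x' = x \<or> R x' x"
      using pR[of x' x] xy xy' uv(2) permutes_inj[OF p] by (auto simp: inj_eq le_less)
    then have "f x' y" using L[of x x' y] xy xy' by auto
    moreover have "y' = y \<or> R y y'"
      using qR[of y y'] xy xy' uv(3) permutes_inj[OF q] by (auto simp: inj_eq le_less)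
    ultimately have "f x' y'" using U[of x' y y'] xy xy' by auto
    then show "(u', v') \<in> G f" using xy' by (auto simp: G_def)
  qed
  have "mono_rel A n (G s)"
  proof (rule mono)
    fix x x' y assume "x < A" "x' < A" "A \<le> y" "y < n" "R x' x" "s x y"
    then show "s x' y" using C1(1)[of x' x y] C1(2)[of x x' y] by (auto simp: R_def)
  next
    fix x y y' assume "x < A" "A \<le> y" "y < n" "A \<le> y'" "y' < n" "R y y'" "s x y"
    then show "s x y'" using C1(1)[of x y y'] C1(2)[of x y' y] by (auto simp: R_def)
  qed
  moreover have "mono_rel A n (G r)"
  proof (rule mono)
    fix x x' y assume "x < A" "x' < A" "A \<le> y" "y < n" "R x' x" "r x y"
    then show "r x' y" using C3(1)[of x' x y] C3(2)[of x x' y] by (auto simp: R_def)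
  next
    fix x y y' assume "x < A" "A \<le> y" "y < n" "A \<le> y'" "y' < n" "R y y'" "r x y"
    then show "r x y'" using C4(1)[of x y y'] C4(2)[of x y' y] by (auto simp: R_def)
  qed
  moreover have "G s \<subseteq> G r" using C2 by (auto simp: G_def)
  ultimately have M: "(G s, G r) \<in> nested_rels A n" by (simp add: nested_rels_def)
  have "s x y = shuffle_lt A p q (G s) x y" if "x < y" "y < n" for x y
    using that pR[of x y] qR[of x y] G_iff[of x y s] by (auto simp: shuffle_lt_def R_def)
  then show ?thesis using that[OF p q M] G_iff by auto
qed

section \<open>The tree T(a,b)\<close>

text \<open>The path \<open>-a, ..., b\<close> is shifted to \<open>0, ..., n - 2\<close> with \<open>n = a + b + 2\<close>, and \<open>A = a + 1\<close>. The
  subpath \<open>x, ..., y - 1\<close> is encoded by the pair \<open>x < y < n\<close>; the leaf \<open>None\<close> can be added to it if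
  it contains the vertex \<open>a\<close>, i.e. if \<open>x < A \<le> y\<close>. Signs of subpaths thus become an order on
  \<open>n\<close> points, namely the order of the partial sums along the path.\<close>
definition seg :: "nat \<Rightarrow> nat \<Rightarrow> nat option set" where
  "seg x y = Some ` {x..<y}"

definition subtrees :: "nat \<Rightarrow> nat \<Rightarrow> nat option set set" where
  "subtrees A n = {seg x y | x y. x < y \<and> y < n} \<union> {{None}} \<union>
     {insert None (seg x y) | x y. x < A \<and> A \<le> y \<and> y < n}"

definition tadj :: "nat \<Rightarrow> nat option \<Rightarrow> nat option \<Rightarrow> bool" where
  "tadj a u v \<longleftrightarrow> u = None \<and> v = Some a \<or> u = Some a \<and> v = None \<or>
     (\<exists>i. u = Some i \<and> v = Some (Suc i)) \<or> (\<exists>i. u = Some (Suc i) \<and> v = Some i)"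

definition tverts :: "nat \<Rightarrow> nat option set" where
  "tverts n = insert None (Some ` {..<n - 1})"

lemma None_notin_seg [simp]: "None \<notin> seg x y"
  by (auto simp: seg_def)

lemma seg_eq_iff: "x < y \<Longrightarrow> seg x y = seg u v \<longleftrightarrow> x = u \<and> y = v"
  unfolding seg_def inj_image_eq_iff[OF inj_Some] by (metis atLeastLessThan_eq_iff atLeastLessThan_empty_iff not_le)

lemma insert_None_seg_eq_iff:
  "x < y \<Longrightarrow> insert None (seg x y) = insert None (seg u v) \<longleftrightarrow> x = u \<and> y = v"
  using seg_eq_iff[of x y u v] by (metis None_notin_seg insert_ident)

lemma subtrees_segI: "x < y \<Longrightarrow> y < n \<Longrightarrow> seg x y \<in> subtrees A n"
  by (auto simp: subtrees_def)

lemma subtrees_insertI: "x < A \<Longrightarrow> A \<le> y \<Longrightarrow> y < n \<Longrightarrow> insert None (seg x y) \<in> subtrees A n"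
  by (auto simp: subtrees_def)

lemma subtrees_NoneI: "{None} \<in> subtrees A n"
  by (simp add: subtrees_def)

lemma subtrees_cases:
  assumes "X \<in> subtrees A n"
  obtains (seg) x y where "X = seg x y" "x < y" "y < n" | (none) "X = {None}"
    | (both) x y where "X = insert None (seg x y)" "x < A" "A \<le> y" "y < n"
  using assms unfolding subtrees_def by blast

lemma conn_imp_subtree:
  assumes "a + 2 \<le> n"
  shows "conn (tadj a) (tverts n) X \<Longrightarrow> X \<in> subtrees (Suc a) n"
proof (induction rule: conn.induct)
  case (single v)
  show ?case
  proof (cases v)
    case (Some i)
    then have "{v} = seg i (Suc i)" "Suc i < n" using single by (auto simp: seg_def tverts_def)
    then show ?thesis by (auto simp: subtrees_def)
  qed (simp add: subtrees_def)
next
  case (insert X u v)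
  show ?case
  proof (cases "v \<in> X")
    case True then show ?thesis using insert by (simp add: insert_absorb)
  next
    case False
    \<comment> \<open>A vertex outside a segment but next to one of its elements prolongs it at one
      of the two ends.\<close>
    have ext: "insert (Some i) (seg x y) = seg x (Suc y) \<and> i = y \<or> insert (Some i) (seg x y) = seg i y \<and> Suc i = x"
      if "x < y" "Some i \<notin> seg x y" "Some j \<in> seg x y" "j = Suc i \<or> i = Suc j" for i j x y
    proof -
      have "i = y \<or> Suc i = x" using that by (auto simp: seg_def image_iff)
      moreover have "insert (Some y) (seg x y) = seg x (Suc y)"
        using that(1) by (auto simp: seg_def atLeastLessThanSuc)
      moreover have "insert (Some i) (seg x y) = seg i y" if "Suc i = x"
        using that \<open>x < y\<close> by (auto simp: seg_def image_iff)
      ultimately show ?thesis by auto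
    qed
    from insert.IH show ?thesis
    proof (cases rule: subtrees_cases)
      case (seg x y)
      then obtain j where j: "u = Some j" "x \<le> j" "j < y" using insert.hyps by (auto simp: seg_def)
      show ?thesis
      proof (cases v)
        case None
        then have "j = a" using insert.hyps j by (simp add: tadj_def)
        then show ?thesis using None seg j by (simp add: subtrees_insertI)
      next
        case (Some i)
        have "i < n - 1" "j = Suc i \<or> i = Suc j" using insert.hyps Some j by (auto simp: tverts_def tadj_def)
        then show ?thesis
          using ext[of x y i j] seg False insert.hyps Some j by (auto intro!: subtrees_segI)
      qed
    next
      case none
      then have "v = Some a" using insert.hyps by (auto simp: tadj_def)
      then have "insert v X = insert None (seg a (Suc a))" using none by (auto simp: seg_def)
      then show ?thesis using assms by (simp add: subtrees_insertI)
    next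
      case (both x y)
      then obtain i where i: "v = Some i" using False by (cases v) auto
      have "u \<noteq> None"
      proof
        assume "u = None"
        then have "v = Some a" using insert.hyps by (simp add: tadj_def)
        then show False using False both by (auto simp: seg_def)
      qed
      then obtain j where j: "u = Some j" "Some j \<in> seg x y" using insert.hyps both by auto
      have *: "i < n - 1" "j = Suc i \<or> i = Suc j" using insert.hyps i j by (auto simp: tverts_def tadj_def)
      have "insert (Some i) (seg x y) = seg x (Suc y) \<and> i = y \<or> insert (Some i) (seg x y) = seg i y \<and> Suc i = x"
        using ext[of x y i j] both i False j *(2) by auto
      then show ?thesis
      proof
        assume e: "insert (Some i) (seg x y) = seg x (Suc y) \<and> i = y"
        then have "insert v X = insert None (seg x (Suc y))" using both i by auto
        then show ?thesis using both * e by (simp add: subtrees_insertI)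
      next
        assume e: "insert (Some i) (seg x y) = seg i y \<and> Suc i = x"
        then have "insert v X = insert None (seg i y)" using both i by auto
        then show ?thesis using both * e by (simp add: subtrees_insertI)
      qed
    qed
  qed
qed

lemma subtree_imp_conn:
  assumes "a + 2 \<le> n" "X \<in> subtrees (Suc a) n"
  shows "conn (tadj a) (tverts n) X"
proof -
  have seg: "conn (tadj a) (tverts n) (seg x (Suc (x + k)))" if "Suc (x + k) < n" for x k
    using that
  proof (induction k)
    case 0
    then show ?case using conn.single[of "Some x" "tverts n"] by (simp add: seg_def tverts_def)
  next
    case (Suc k)
    have "insert (Some (Suc (x + k))) (seg x (Suc (x + k))) = seg x (Suc (x + Suc k))"
      by (auto simp: seg_def atLeastLessThanSuc)
    moreover have "conn (tadj a) (tverts n) (seg x (Suc (x + k)))" using Suc by simp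
    then have "conn (tadj a) (tverts n) (insert (Some (Suc (x + k))) (seg x (Suc (x + k))))"
      by (rule conn.insert[where x = "Some (x + k)"])
        (use Suc.prems in \<open>simp_all add: seg_def tverts_def tadj_def\<close>)
    ultimately show ?case by simp
  qed
  have seg': "conn (tadj a) (tverts n) (seg x y)" if "x < y" "y < n" for x y
    using seg[of x "y - Suc x"] that by simp
  from assms(2) show ?thesis
  proof (cases rule: subtrees_cases)
    case (seg x y) then show ?thesis using seg' by simp
  next
    case none then show ?thesis using conn.single[of None "tverts n"] by (simp add: tverts_def)
  next
    case (both x y)
    then show ?thesis
      using conn.insert[OF seg'[of x y], of "Some a" None] by (auto simp: seg_def tverts_def tadj_def)
  qed
qed

lemma conn_eq_subtrees: "a + 2 \<le> n \<Longrightarrow> {X. conn (tadj a) (tverts n) X} = subtrees (Suc a) n"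
  using conn_imp_subtree subtree_imp_conn by blast

section \<open>Splittings of subtrees and the two orders\<close>

lemma interval_split_less:
  fixes x y u v s t :: nat
  assumes "x < y" "u < v" "s < t" "{x..<y} \<inter> {u..<v} = {}" "{s..<t} = {x..<y} \<union> {u..<v}" "x < u"
  shows "x = s \<and> y = u \<and> v = t"
proof -
  have mem: "s \<le> z \<and> z < t \<longleftrightarrow> x \<le> z \<and> z < y \<or> u \<le> z \<and> z < v" for z
    using assms(5) by (auto simp: set_eq_iff)
  have "u \<notin> {x..<y}" using assms(2,4) by fastforce
  then have yu: "y \<le> u" using assms by simp
  have s: "s = x" using mem[of s] mem[of x] assms by linarith
  have "u < t" using mem[of u] assms by linarith
  then have "y = u" using mem[of y] yu s assms by linarith
  moreover have "v = t" using mem[of v] mem[of "v - 1"] yu s assms by linarith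
  ultimately show ?thesis using s by simp
qed

lemma interval_split:
  fixes x y u v s t :: nat
  assumes "x < y" "u < v" "s < t" "{x..<y} \<inter> {u..<v} = {}" "{s..<t} = {x..<y} \<union> {u..<v}"
  shows "x = s \<and> y = u \<and> v = t \<or> u = s \<and> v = x \<and> y = t"
proof (cases x u rule: linorder_cases)
  case less then show ?thesis using interval_split_less[OF assms] by simp
next
  case greater
  then show ?thesis
    using interval_split_less[of u v x y s t] assms by (simp add: Int_commute Un_commute)
next
  case equal
  then have "x \<in> {x..<y} \<inter> {u..<v}" using assms by simp
  then show ?thesis using assms(4) by simp
qed

lemma seg_split:
  assumes "x < y" "u < v" "s < t" "seg x y \<inter> seg u v = {}" "seg s t = seg x y \<union> seg u v"
  shows "x = s \<and> y = u \<and> v = t \<or> u = s \<and> v = x \<and> y = t"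
  using assms unfolding seg_def image_Un[symmetric] image_Int[OF inj_Some, symmetric] inj_image_eq_iff[OF inj_Some]
  by (intro interval_split) auto

lemma seg_Un: "x \<le> y \<Longrightarrow> y \<le> z \<Longrightarrow> seg x y \<union> seg y z = seg x z"
  unfolding seg_def image_Un[symmetric] by (simp add: ivl_disj_un_two(3))

lemma seg_Int: "seg x y \<inter> seg y z = {}"
  by (auto simp: seg_def)

text \<open>At most one part contains the leaf, so \<open>X\<close> may be taken to avoid it. The
  four shapes are matched by the four clauses of \<open>shuffle_cond\<close>.\<close>

lemma subtrees_dsplit_cases:
  assumes "X \<in> subtrees A n" "Y \<in> subtrees A n" "Z \<in> subtrees A n" "dsplit X Y Z" "None \<notin> X"
  obtains (seg) x y z where "x < y" "y < z" "z < n" "{X, Y} = {seg x y, seg y z}" "Z = seg x z"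
  | (none) x y where "x < A" "A \<le> y" "y < n" "X = seg x y" "Y = {None}" "Z = insert None (seg x y)"
  | (left) x y z where "x < y" "y < A" "A \<le> z" "z < n" "X = seg x y" "Y = insert None (seg y z)"
      "Z = insert None (seg x z)"
  | (right) x y z where "x < A" "A \<le> y" "y < z" "z < n" "X = seg y z" "Y = insert None (seg x y)"
      "Z = insert None (seg x z)"
proof -
  have Z: "X \<inter> Y = {}" "Z = X \<union> Y" using assms(4) by (auto simp: dsplit_def)
  obtain x y where X: "X = seg x y" "x < y" "y < n"
    using subtrees_cases[OF assms(1)] assms(5) by (metis insertI1)
  have ne: "seg x y \<noteq> {}" using X by (auto simp: seg_def)
  from assms(2) show ?thesis
  proof (cases rule: subtrees_cases)
    case 1: (seg u v)
    then obtain s t where st: "Z = seg s t" "s < t" "t < n"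
      using subtrees_cases[OF assms(3)] assms(5) Z(2) 1(1) by (metis None_notin_seg UnE insertI1)
    have "seg x y \<inter> seg u v = {}" "seg s t = seg x y \<union> seg u v" using Z X 1 st by simp_all
    then have "x = s \<and> y = u \<and> v = t \<or> u = s \<and> v = x \<and> y = t"
      by (rule seg_split[OF X(2) 1(2) st(2)])
    then show ?thesis using seg[of x y v] seg[of u x y] X 1 st by auto
  next
    case 2: none
    then obtain s t where st: "Z = insert None (seg s t)" "s < A" "A \<le> t" "t < n"
      using subtrees_cases[OF assms(3)] Z(2) X(1) ne 2
      by (metis None_notin_seg UnI1 UnI2 ex_in_conv insertI1 singletonD)
    then have "x = s \<and> y = t"
      using insert_None_seg_eq_iff[of x y s t] Z X 2 by auto
    then show ?thesis using none[of x y] X 2 st by auto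
  next
    case 3: (both u v)
    then obtain s t where st: "Z = insert None (seg s t)" "s < A" "A \<le> t" "t < n"
      using subtrees_cases[OF assms(3)] Z(2) X(1) ne 3(1)
      by (metis None_notin_seg UnI1 UnI2 ex_in_conv insertI1 singletonD)
    have "insert None (seg s t) = insert None (seg x y \<union> seg u v)" using Z X 3 st by auto
    then have "seg s t = seg x y \<union> seg u v" by (subst (asm) insert_ident) auto
    then have "x = s \<and> y = u \<and> v = t \<or> u = s \<and> v = x \<and> y = t"
      using seg_split[of x y u v s t] Z X 3 st by auto
    then show ?thesis using left[of x y v] right[of u v y] X 3 st by auto
  qed
qed

text \<open>With \<open>{None}\<close> in \<open>P\<close>, one half of the condition for splitting
  off the leaf is automatic; what is left is that adding the leaf preserves membership, the second
  clause of \<open>shuffle_cond\<close>.\<close>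

lemma bic_subtrees_iff:
  assumes P: "P \<subseteq> subtrees A n" "{None} \<in> P"
  shows "bic (subtrees A n) dsplit P \<longleftrightarrow>
    shuffle_cond A n (\<lambda>x y. seg x y \<in> P) (\<lambda>x y. insert None (seg x y) \<in> P)"
proof
  assume b: "bic (subtrees A n) dsplit P"
  have sp: "(X \<in> P \<and> Y \<in> P \<longrightarrow> Z \<in> P) \<and> (Z \<in> P \<longrightarrow> X \<in> P \<or> Y \<in> P)"
    if "X \<in> subtrees A n" "Y \<in> subtrees A n" "Z \<in> subtrees A n" "X \<inter> Y = {}" "Z = X \<union> Y" for X Y Z
    using b that unfolding bic_def dsplit_def by blast
  have s: "seg x y \<in> subtrees A n" if "x < y" "y < n" for x y
    using that by (auto simp: subtrees_def)
  have r: "insert None (seg x y) \<in> subtrees A n" if "x < A" "A \<le> y" "y < n" for x y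
    using that by (auto simp: subtrees_def)
  have 1: "(seg x y \<in> P \<and> seg y z \<in> P \<longrightarrow> seg x z \<in> P) \<and> (seg x z \<in> P \<longrightarrow> seg x y \<in> P \<or> seg y z \<in> P)"
    if "x < y" "y < z" "z < n" for x y z
    by (rule sp[OF s s s seg_Int seg_Un[symmetric]]) (use that in auto)
  have 2: "insert None (seg x y) \<in> P" if "x < A" "A \<le> y" "y < n" "seg x y \<in> P" for x y
    using sp[of "seg x y" "{None}" "insert None (seg x y)", OF s subtrees_NoneI r] that P(2) by simp
  have 3: "(seg x y \<in> P \<and> insert None (seg y z) \<in> P \<longrightarrow> insert None (seg x z) \<in> P) \<and>
      (insert None (seg x z) \<in> P \<longrightarrow> seg x y \<in> P \<or> insert None (seg y z) \<in> P)"
    if "x < y" "y < A" "A \<le> z" "z < n" for x y z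
    by (rule sp[OF s r r]) (use that seg_Int seg_Un[of x y z] in auto)
  have 4: "(insert None (seg x y) \<in> P \<and> seg y z \<in> P \<longrightarrow> insert None (seg x z) \<in> P) \<and>
      (insert None (seg x z) \<in> P \<longrightarrow> insert None (seg x y) \<in> P \<or> seg y z \<in> P)"
    if "x < A" "A \<le> y" "y < z" "z < n" for x y z
    by (rule sp[OF r s r]) (use that seg_Int seg_Un[of x y z] in auto)
  show "shuffle_cond A n (\<lambda>x y. seg x y \<in> P) (\<lambda>x y. insert None (seg x y) \<in> P)"
    unfolding shuffle_cond_def
    using 1 2 3 4 by simp
next
  assume c: "shuffle_cond A n (\<lambda>x y. seg x y \<in> P) (\<lambda>x y. insert None (seg x y) \<in> P)"
  have main: "(X \<in> P \<and> Y \<in> P \<longrightarrow> Z \<in> P) \<and> (Z \<in> P \<longrightarrow> X \<in> P \<or> Y \<in> P)"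
    if XYZ: "X \<in> subtrees A n" "Y \<in> subtrees A n" "Z \<in> subtrees A n" "dsplit X Y Z" "None \<notin> X" for X Y Z
    using XYZ
  proof (cases rule: subtrees_dsplit_cases)
    case (seg x y z)
    have "(seg x y \<in> P \<and> seg y z \<in> P \<longrightarrow> Z \<in> P) \<and> (Z \<in> P \<longrightarrow> seg x y \<in> P \<or> seg y z \<in> P)"
      using c seg(1-3,5) unfolding shuffle_cond_def by blast
    then show ?thesis using seg(4) by (auto simp: doubleton_eq_iff)
  next
    case (none x y)
    then show ?thesis using c P(2) unfolding shuffle_cond_def by blast
  next
    case (left x y z)
    then show ?thesis using c unfolding shuffle_cond_def by blast
  next
    case (right x y z)
    then show ?thesis using c unfolding shuffle_cond_def by blast
  qed
  show "bic (subtrees A n) dsplit P"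
    unfolding bic_def
  proof (intro conjI ballI impI P(1))
    fix X Y Z assume XYZ: "X \<in> subtrees A n" "Y \<in> subtrees A n" "Z \<in> subtrees A n" "dsplit X Y Z"
    then have "None \<notin> X \<or> None \<notin> Y" "dsplit Y X Z" by (auto simp: dsplit_def)
    then show "X \<in> P \<and> Y \<in> P \<Longrightarrow> Z \<in> P" "Z \<in> P \<Longrightarrow> X \<in> P \<or> Y \<in> P"
      using main[of X Y Z] main[of Y X Z] XYZ by blast+
  qed
qed

section \<open>Counting biclosed families of subtrees\<close>

lemma finite_subtrees: "finite (subtrees A n)"
proof -
  have "subtrees A n \<subseteq> Pow (tverts (Suc n))"
    by (auto simp: subtrees_def tverts_def seg_def)
  then show ?thesis by (rule finite_subset) (simp add: tverts_def)
qed

lemma bic_compl: "bic K R P \<Longrightarrow> bic K R (K - P)"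
  unfolding bic_def by blast

text \<open>Complementation is an involution on biclosed families that flips the membership of
  \<open>x\<close>.\<close>

lemma card_bic_half:
  assumes "finite K" "x \<in> K"
  shows "card {P. bic K R P} = 2 * card {P. bic K R P \<and> x \<in> P}"
proof -
  have fin: "finite {P. bic K R P}"
    by (rule finite_subset[of _ "Pow K"]) (use assms in \<open>auto simp: bic_def\<close>)
  have sub: "K - (K - P) = P" if "bic K R P" for P using that by (auto simp: bic_def)
  have "bij_betw ((-) K) {P. bic K R P \<and> x \<in> P} {P. bic K R P \<and> x \<notin> P}"
    by (rule bij_betw_byWitness[where f' = "(-) K"]) (use sub bic_compl[of K R] assms in auto)
  then have "card {P. bic K R P \<and> x \<in> P} = card {P. bic K R P \<and> x \<notin> P}"
    by (rule bij_betw_same_card)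
  moreover have "card ({P. bic K R P \<and> x \<in> P} \<union> {P. bic K R P \<and> x \<notin> P}) =
      card {P. bic K R P \<and> x \<in> P} + card {P. bic K R P \<and> x \<notin> P}"
    by (rule card_Un_disjoint) (use fin in auto)
  moreover have "{P. bic K R P \<and> x \<in> P} \<union> {P. bic K R P \<and> x \<notin> P} = {P. bic K R P}" by blast
  ultimately show ?thesis by simp
qed

text \<open>\<open>{None}\<close> is always included, as only the families with a positive leaf are
  encoded.\<close>

definition family_of ::
  "nat \<Rightarrow> nat \<Rightarrow> (nat \<Rightarrow> nat) \<times> (nat \<Rightarrow> nat) \<times> (nat \<times> nat) set \<times> (nat \<times> nat) set \<Rightarrow> nat option set set" where
  "family_of A n = (\<lambda>(p, q, M, M'). {seg x y | x y. x < y \<and> y < n \<and> shuffle_lt A p q M x y} \<union> {{None}} \<union>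
     {insert None (seg x y) | x y. x < A \<and> A \<le> y \<and> y < n \<and> (p x, q y) \<in> M'})"

lemma seg_in_family_of:
  assumes "x < y" "y < n"
  shows "seg x y \<in> family_of A n (p, q, M, M') \<longleftrightarrow> shuffle_lt A p q M x y"
proof -
  have "seg x y \<noteq> insert None Z" for Z by (metis None_notin_seg insertI1)
  then show ?thesis using assms by (auto simp: family_of_def seg_eq_iff)
qed

lemma insert_None_seg_in_family_of:
  assumes "x < A" "A \<le> y" "y < n"
  shows "insert None (seg x y) \<in> family_of A n (p, q, M, M') \<longleftrightarrow> (p x, q y) \<in> M'"
proof -
  have xy: "x < y" using assms by simp
  have "insert None (seg x y) \<noteq> seg u v" for u v by (metis None_notin_seg insertI1)
  moreover have "insert None (seg x y) \<noteq> {None}"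
  proof -
    have "Some x \<in> seg x y" using xy by (simp add: seg_def)
    then show ?thesis by auto
  qed
  ultimately show ?thesis using assms by (auto simp: family_of_def insert_None_seg_eq_iff[OF xy])
qed

lemma None_in_family_of: "{None} \<in> family_of A n d"
  by (cases d) (simp add: family_of_def)

lemma family_of_subset: "family_of A n d \<subseteq> subtrees A n"
  by (cases d) (auto simp: family_of_def subtrees_def)

lemma subtrees_family_eqI:
  assumes "P \<subseteq> subtrees A n" "Q \<subseteq> subtrees A n" "{None} \<in> P" "{None} \<in> Q"
    and "\<And>x y. x < y \<Longrightarrow> y < n \<Longrightarrow> seg x y \<in> P \<longleftrightarrow> seg x y \<in> Q"
    and "\<And>x y. x < A \<Longrightarrow> A \<le> y \<Longrightarrow> y < n \<Longrightarrow> insert None (seg x y) \<in> P \<longleftrightarrow> insert None (seg x y) \<in> Q"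
  shows "P = Q"
proof -
  have "X \<in> P \<longleftrightarrow> X \<in> Q" if "X \<in> subtrees A n" for X
    using that by (cases rule: subtrees_cases) (use assms(3-6) in simp_all)
  then show ?thesis using assms(1,2) by blast
qed

lemma nested_rels_eqI:
  fixes A n :: nat
  assumes p: "p permutes {0..<A}" and q: "q permutes {A..<n}"
    and M: "M \<subseteq> {..<A} \<times> {A..<n}" and N: "N \<subseteq> {..<A} \<times> {A..<n}"
    and iff: "\<And>x y. x < A \<Longrightarrow> A \<le> y \<Longrightarrow> y < n \<Longrightarrow> (p x, q y) \<in> M \<longleftrightarrow> (p x, q y) \<in> N"
  shows "M = N"
proof -
  have "(u, v) \<in> M \<longleftrightarrow> (u, v) \<in> N" if "u < A" "A \<le> v" "v < n" for u v
  proof -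
    have "u \<in> p ` {0..<A}" "v \<in> q ` {A..<n}"
      using that by (simp_all add: permutes_image[OF p] permutes_image[OF q])
    then show ?thesis using iff by auto
  qed
  then have "(u, v) \<in> M \<longleftrightarrow> (u, v) \<in> N" for u v
    using subsetD[OF M, of "(u, v)"] subsetD[OF N, of "(u, v)"] by auto
  then show ?thesis by auto
qed

lemma bij_betw_family_of:
  assumes "A \<le> n"
  shows "bij_betw (family_of A n)
    ({p. p permutes {0..<A}} \<times> {q. q permutes {A..<n}} \<times> nested_rels A n)
    {P. bic (subtrees A n) dsplit P \<and> {None} \<in> P}"
proof (rule bij_betw_imageI)
  let ?D = "{p. p permutes {0..<A}} \<times> {q. q permutes {A..<n}} \<times> nested_rels A n"
  show "inj_on (family_of A n) ?D"
  proof (rule inj_onI)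
    fix d e assume d: "d \<in> ?D" and e: "e \<in> ?D" and eq: "family_of A n d = family_of A n e"
    obtain p q M M' where dd: "d = (p, q, M, M')" by (cases d)
    obtain p2 q2 N N' where ee: "e = (p2, q2, N, N')" by (cases e)
    have p: "p permutes {0..<A}" "p2 permutes {0..<A}" and q: "q permutes {A..<n}" "q2 permutes {A..<n}"
      using d e by (auto simp: dd ee)
    have sub: "M \<subseteq> {..<A} \<times> {A..<n}" "M' \<subseteq> {..<A} \<times> {A..<n}" "N \<subseteq> {..<A} \<times> {A..<n}" "N' \<subseteq> {..<A} \<times> {A..<n}"
      using d e by (auto simp: dd ee nested_rels_def mono_rel_def)
    have s: "shuffle_lt A p q M x y \<longleftrightarrow> shuffle_lt A p2 q2 N x y" if "x < y" "y < n" for x y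
      using seg_in_family_of[OF that, of A p q M M'] seg_in_family_of[OF that, of A p2 q2 N N'] eq
      by (simp add: dd ee)
    have r: "(p x, q y) \<in> M' \<longleftrightarrow> (p2 x, q2 y) \<in> N'" if "x < A" "A \<le> y" "y < n" for x y
      using insert_None_seg_in_family_of[OF that, of p q M M']
        insert_None_seg_in_family_of[OF that, of p2 q2 N N'] eq by (simp add: dd ee)
    have pp: "p = p2"
    proof (rule permutes_eq_if_same_order[OF p])
      fix x y assume "x < y" "y < A"
      then show "p x < p y \<longleftrightarrow> p2 x < p2 y" using s[of x y] assms by (simp add: shuffle_lt_def)
    qed
    have qq: "q = q2"
    proof (rule permutes_eq_if_same_order[OF q])
      fix x y assume "A \<le> x" "x < y" "y < n"
      then show "q x < q y \<longleftrightarrow> q2 x < q2 y" using s[of x y] by (simp add: shuffle_lt_def)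
    qed
    have "M = N"
    proof (rule nested_rels_eqI[OF p(1) q(1) sub(1,3)])
      fix x y assume "x < A" "A \<le> y" "y < n"
      then show "(p x, q y) \<in> M \<longleftrightarrow> (p x, q y) \<in> N"
        using s[of x y] pp qq by (simp add: shuffle_lt_def)
    qed
    moreover have "M' = N'"
      by (rule nested_rels_eqI[OF p(1) q(1) sub(2,4)]) (use r pp qq in simp)
    ultimately show "d = e" using pp qq by (simp add: dd ee)
  qed
  show "family_of A n ` ?D = {P. bic (subtrees A n) dsplit P \<and> {None} \<in> P}"
  proof (intro subset_antisym subsetI)
    fix P assume "P \<in> family_of A n ` ?D"
    then obtain p q M M' where D: "p permutes {0..<A}" "q permutes {A..<n}" "(M, M') \<in> nested_rels A n"
      and P: "P = family_of A n (p, q, M, M')" by auto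
    have "shuffle_cond A n (\<lambda>x y. seg x y \<in> P) (\<lambda>x y. insert None (seg x y) \<in> P)"
      using shuffle_cond_shuffle_lt[OF assms D] unfolding shuffle_cond_def P
      by (simp add: seg_in_family_of insert_None_seg_in_family_of)
    then show "P \<in> {P. bic (subtrees A n) dsplit P \<and> {None} \<in> P}"
      using bic_subtrees_iff[of P A n] family_of_subset None_in_family_of by (simp add: P)
  next
    fix P assume P: "P \<in> {P. bic (subtrees A n) dsplit P \<and> {None} \<in> P}"
    then have sub: "P \<subseteq> subtrees A n" by (simp add: bic_def)
    then have "shuffle_cond A n (\<lambda>x y. seg x y \<in> P) (\<lambda>x y. insert None (seg x y) \<in> P)"
      using bic_subtrees_iff[of P A n] P by simp
    then obtain p q M M' where D: "p permutes {0..<A}" "q permutes {A..<n}" "(M, M') \<in> nested_rels A n"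
      and s: "\<forall>x y. x < y \<longrightarrow> y < n \<longrightarrow> (seg x y \<in> P) = shuffle_lt A p q M x y"
      and r: "\<forall>x y. x < A \<longrightarrow> A \<le> y \<longrightarrow> y < n \<longrightarrow> (insert None (seg x y) \<in> P) = ((p x, q y) \<in> M')"
      by (rule shuffle_cond_obtains[OF assms])
    have "P = family_of A n (p, q, M, M')"
      by (rule subtrees_family_eqI[OF sub family_of_subset _ None_in_family_of])
        (use P s r in \<open>simp_all add: seg_in_family_of insert_None_seg_in_family_of\<close>)
    then show "P \<in> family_of A n ` ?D" using D by blast
  qed
qed

lemma card_bic_subtrees:
  "card {P. bic (subtrees (Suc a) (a + b + 2)) dsplit P} =
    2 * (a + b + 3) * (fact (a + b + 2) div fact (b + 2)) * (fact (a + b + 2) div fact (a + 2))"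
proof -
  define n where "n = Suc a + Suc b"
  have n: "a + b + 2 = n" by (simp add: n_def)
  have "card {P. bic (subtrees (Suc a) n) dsplit P \<and> {None} \<in> P} =
      fact (Suc a) * (fact (Suc b) * card (nested_rels (Suc a) n))"
    using bij_betw_same_card[OF bij_betw_family_of[of "Suc a" n]] card_permutations[of "{0..<Suc a}" "Suc a"]
      card_permutations[of "{Suc a..<n}" "Suc b"]
    by (simp add: card_cartesian_product n_def)
  then have "int (card {P. bic (subtrees (Suc a) n) dsplit P \<and> {None} \<in> P}) =
      nested_count (Suc a) (Suc b) (Suc b) * int (fact (Suc a)) * int (fact (Suc b))"
    using card_nested_rels[of "Suc a" "Suc b"] by (simp add: n_def ac_simps)
  also have "\<dots> = int ((a + b + 3) * (fact (a + b + 2) div fact (b + 2)) * (fact (a + b + 2) div fact (a + 2)))"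
    by (rule nested_count_fact)
  finally have "card {P. bic (subtrees (Suc a) n) dsplit P \<and> {None} \<in> P} =
      (a + b + 3) * (fact (a + b + 2) div fact (b + 2)) * (fact (a + b + 2) div fact (a + 2))"
    by (simp only: of_nat_eq_iff)
  then show ?thesis
    using card_bic_half[OF finite_subtrees subtrees_NoneI, of "Suc a" n dsplit]
    by (simp only: n mult.assoc)
qed

lemma card_bic_Tab:
  "card {P. bic {X. conn Tab_adj (Tab_vertices a b) X} dsplit P} =
    2 * (a + b + 3) * (fact (a + b + 2) div fact (b + 2)) * (fact (a + b + 2) div fact (a + 2))"
proof -
  let ?h = "map_option (\<lambda>i. nat (i + int a))"
  have "bij_betw ?h (Tab_vertices a b) (tverts (a + b + 2))"
    by (rule bij_betw_byWitness[where f' = "map_option (\<lambda>i. int i - int a)"])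
      (auto simp: Tab_vertices_def tverts_def image_iff)
  moreover have "Tab_adj u v \<longleftrightarrow> tadj a (?h u) (?h v)"
    if "u \<in> Tab_vertices a b" "v \<in> Tab_vertices a b" for u v
    using that by (cases u; cases v) (auto simp: Tab_vertices_def Tab_adj_def tadj_def)
  ultimately have "card {P. bic {X. conn Tab_adj (Tab_vertices a b) X} dsplit P} =
      card {P. bic {X. conn (tadj a) (tverts (a + b + 2)) X} dsplit P}"
    by (rule card_bic_conn_iso)
  then show ?thesis by (simp only: conn_eq_subtrees le_add2 card_bic_subtrees)
qed

theorem theorem9p6:
  fixes n a b :: nat and D :: "(nat \<times> nat) set"
  assumes "n \<ge> 2"
    and "is_triangulation (n + 2) D"
    and "a + b + 2 = n"
    and "dual_tree_iso_Tab (n + 2) D a b"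
  shows "card {S. maximal_separated_collection (skeleton_edges (n + 2) D) S}
           = 2 * (n + 1) * (fact n div fact (n - a)) * (fact n div fact (n - b))"
proof -
  obtain f where f: "bij_betw f (triangles (n + 2) D) (Tab_vertices a b)"
    and adj: "\<forall>s\<in>triangles (n + 2) D. \<forall>t\<in>triangles (n + 2) D. dual_adj D s t \<longleftrightarrow> Tab_adj (f s) (f t)"
    using assms(4) by (auto simp: dual_tree_iso_Tab_def)
  have "card {S. maximal_separated_collection (skeleton_edges (n + 2) D) S} =
      card {P. bic {X. conn (dual_adj D) (triangles (n + 2) D) X} dsplit P}"
    using assms(1) by (intro card_maximal_separated_eq[OF _ assms(2)]) simp
  also have "\<dots> = card {P. bic {X. conn Tab_adj (Tab_vertices a b) X} dsplit P}"
    by (rule card_bic_conn_iso[OF f]) (use adj in blast)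
  also have "\<dots> = 2 * (a + b + 3) * (fact (a + b + 2) div fact (b + 2)) * (fact (a + b + 2) div fact (a + 2))"
    by (rule card_bic_Tab)
  also have "\<dots> = 2 * (n + 1) * (fact n div fact (n - a)) * (fact n div fact (n - b))"
  proof -
    have "n - a = b + 2" "n - b = a + 2" "a + b + 3 = n + 1" using assms(3) by simp_all
    then show ?thesis by (simp only: assms(3))
  qed
  finally show ?thesis .
qed

end
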